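(* Let $(K,\mathcal{K})$ be a directed Euclidean cubical complex in $\mathbb{R}^n$ such that there exist cubes $\tau,\sigma\in\mathcal{K}$ with $\tau$ a free face of $\sigma$. Then $(\tau,\sigma)$ is an LPDC pair if and only if $\min(\sigma)\notin \mathrm{verts}(\tau)$.
   Context: Order: for $p,q\in\mathbb{R}^n$, $p\preceq q$ means $p_i\le q_i$ for every $i$, and $[p,q]:=\{x\in\mathbb{R}^n : p\preceq x\preceq q\}$. Cubes: an elementary cube in $\mathbb{R}^n$ is a set $[v-j,v]$ with $v\in\mathbb{Z}^n$, $j\in\{0,1\}^n$; its dimension is $\sum_i j_i$, its minimum vertex is $\min([v-j,v])=v-j$ and its maximum vertex is $\max([v-j,v])=v$. If $\tau\subseteq\sigma$ are elementary cubes, $\tau$ is a face of $\sigma$ and $\sigma$ is a coface of $\tau$. Complexes: a (directed) Euclidean cubical complex $(K,\mathcal{K})$ in $\mathbb{R}^n$ is a subspace $K\subsetneq\mathbb{R}^n$ that is a finite union of elementary cubes, together with the stratification $\mathcal{K}$ of $K$ whose strata are the relative interiors of the elementary cubes contained in $K$ (a vertex being its own relative interior). For $\sigma\in\mathcal{K}$, $\overline{\sigma}$ is the corresponding closed elementary cube; $\min$, $\max$, dimension, faces and the vertex set $\mathrm{verts}(\sigma)$ of $\sigma$ refer to $\overline{\sigma}$ (so $\mathrm{verts}(\sigma)=\overline{\sigma}\cap\mathbb{Z}^n$). $\mathrm{verts}(K)=K\cap\mathbb{Z}^n$ is the set of zero-cubes of $K$. A cube of $K$ is maximal if it has no proper coface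 in $K$. Past link: for $v\in\mathbb{Z}^n$, $\mathrm{lk}^-_K(v):=\{j\in\{0,1\}^n\setminus\{\mathbf 0\} : [v-j,v]\subseteq K\}$, viewed as an abstract simplicial complex in which $j$ stands for the simplex $\{x_i : j_i=1\}$ on vertices among $x_1,\dots,x_n$. Topological statements about it refer to its geometric realization. Collapse: $\tau$ is a free face of $\sigma$ if $\sigma$ is a maximal cube, $\tau$ is a proper face of $\sigma$, and no other maximal cube of $K$ contains $\tau$. In that case the $(\tau,\sigma)$-collapse of $K$ is the subcomplex $K'$ obtained from $K$ by removing all (open) cubes $\gamma\in\mathcal{K}$ with $\overline{\tau}\subseteq\overline{\gamma}\subseteq\overline{\sigma}$. The pair $(\tau,\sigma)$ is an LPDC pair (and $K'$ a link-preserving directed collapse, LPDC, of $K$) if $\mathrm{lk}^-_K(v)$ is homotopy equivalent to $\mathrm{lk}^-_{K'}(v)$ for all $v\in\mathrm{verts}(K')$. *)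

theory Defs
  imports "HOL-Analysis.Analysis"
begin

text \<open>
  The order on \<open>real ^ 'n\<close> is the library's componentwise order, so \<open>{p..q}\<close> is the box
  of all \<open>x\<close> with \<open>p\<close> below \<open>x\<close> below \<open>q\<close> in every coordinate.
\<close>

definition integer_vectors :: "(real ^ 'n) set" where
  "integer_vectors = {v. \<forall>i. v $ i \<in> \<int>}"

definition binary_vectors :: "(real ^ 'n) set" where
  "binary_vectors = {j. \<forall>i. j $ i \<in> {0, 1}}"

definition elementary_cube :: "(real ^ 'n) set \<Rightarrow> bool" where
  "elementary_cube c \<longleftrightarrow> (\<exists>v\<in>integer_vectors. \<exists>j\<in>binary_vectors. c = {v - j..v})"

definition cubical_complex :: "(real ^ 'n) set \<Rightarrow> bool" where
  "cubical_complex K \<longleftrightarrow>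
     K \<subset> UNIV \<and> (\<exists>C. finite C \<and> (\<forall>c\<in>C. elementary_cube c) \<and> K = \<Union>C)"

text \<open>
  The cubes of a complex are its strata, which are relatively open; the closed cube
  belonging to a stratum \<open>\<sigma>\<close> is \<open>closure \<sigma>\<close>, and vertices, minima and the face relation
  all refer to it.
\<close>

definition strata :: "(real ^ 'n) set \<Rightarrow> (real ^ 'n) set set" where
  "strata K = rel_interior ` {c. elementary_cube c \<and> c \<subseteq> K}"

definition min_vertex :: "(real ^ 'n) set \<Rightarrow> real ^ 'n" where
  "min_vertex \<sigma> =
     (THE p. \<exists>v\<in>integer_vectors. \<exists>j\<in>binary_vectors. closure \<sigma> = {v - j..v} \<and> p = v - j)"

definition cube_verts :: "(real ^ 'n) set \<Rightarrow> (real ^ 'n) set" where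
  "cube_verts \<sigma> = closure \<sigma> \<inter> integer_vectors"

definition complex_verts :: "(real ^ 'n) set \<Rightarrow> (real ^ 'n) set" where
  "complex_verts K = K \<inter> integer_vectors"

definition face :: "(real ^ 'n) set \<Rightarrow> (real ^ 'n) set \<Rightarrow> bool" where
  "face \<tau> \<sigma> \<longleftrightarrow> closure \<tau> \<subseteq> closure \<sigma>"

definition maximal_cube :: "(real ^ 'n) set \<Rightarrow> (real ^ 'n) set \<Rightarrow> bool" where
  "maximal_cube K \<sigma> \<longleftrightarrow> \<sigma> \<in> strata K \<and> (\<forall>\<rho>\<in>strata K. face \<sigma> \<rho> \<longrightarrow> \<rho> = \<sigma>)"

definition free_face :: "(real ^ 'n) set \<Rightarrow> (real ^ 'n) set \<Rightarrow> (real ^ 'n) set \<Rightarrow> bool" where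
  "free_face K \<tau> \<sigma> \<longleftrightarrow>
     maximal_cube K \<sigma> \<and> \<tau> \<in> strata K \<and> face \<tau> \<sigma> \<and> \<tau> \<noteq> \<sigma> \<and>
     (\<forall>\<rho>. maximal_cube K \<rho> \<and> face \<tau> \<rho> \<longrightarrow> \<rho> = \<sigma>)"

definition collapse :: "(real ^ 'n) set \<Rightarrow> (real ^ 'n) set \<Rightarrow> (real ^ 'n) set \<Rightarrow> (real ^ 'n) set" where
  "collapse K \<tau> \<sigma> = K - \<Union>{\<gamma> \<in> strata K. face \<tau> \<gamma> \<and> face \<gamma> \<sigma>}"

definition past_link :: "(real ^ 'n) set \<Rightarrow> real ^ 'n \<Rightarrow> (real ^ 'n) set" where
  "past_link K v = {j \<in> binary_vectors - {0}. {v - j..v} \<subseteq> K}"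

definition past_link_complex :: "(real ^ 'n) set \<Rightarrow> real ^ 'n \<Rightarrow> 'n set set" where
  "past_link_complex K v = (\<lambda>j. {i. j $ i = 1}) ` past_link K v"

text \<open>
  Geometric realization inside the standard simplex: the vertex \<open>i\<close> is placed at the unit
  vector \<open>axis i 1\<close>. Since the vertex set is finite, the subspace topology is the usual one.
\<close>

definition geometric_realization :: "'n set set \<Rightarrow> (real ^ 'n) set" where
  "geometric_realization S = (\<Union>s\<in>S. convex hull ((\<lambda>i. axis i 1) ` s))"

definition lpdc_pair :: "(real ^ 'n) set \<Rightarrow> (real ^ 'n) set \<Rightarrow> (real ^ 'n) set \<Rightarrow> bool" where
  "lpdc_pair K \<tau> \<sigma> \<longleftrightarrow> free_face K \<tau> \<sigma> \<and>
     (\<forall>v\<in>complex_verts (collapse K \<tau> \<sigma>).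
        geometric_realization (past_link_complex K v) homotopy_eqv
        geometric_realization (past_link_complex (collapse K \<tau> \<sigma>) v))"

lemma binary_vectors_nonneg: "j \<in> binary_vectors \<Longrightarrow> 0 \<le> j"
  unfolding binary_vectors_def less_eq_vec_def by (simp, metis order_refl zero_le_one)

lemma closure_rel_interior_elementary_cube:
  fixes c :: "(real ^ 'n) set"
  assumes "elementary_cube c"
  shows "closure (rel_interior c) = c"
proof -
  obtain v j :: "real ^ 'n" where c: "c = cbox (v - j) v"
    using assms unfolding elementary_cube_def by (auto simp: interval_cbox)
  show ?thesis
    unfolding c by (simp add: convex_closure_rel_interior)
qed

lemma min_vertex_cube:
  fixes v j :: "real ^ 'n"
  assumes "v \<in> integer_vectors" "j \<in> binary_vectors"
  shows "min_vertex (rel_interior {v - j..v}) = v - j"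
proof -
  have cl: "closure (rel_interior {v - j..v}) = {v - j..v}"
    using assms by (intro closure_rel_interior_elementary_cube) (auto simp: elementary_cube_def)
  have "p = v - j" if "w \<in> integer_vectors" "k \<in> binary_vectors"
      "{v - j..v} = {w - k..w}" "p = w - k" for p w k :: "real ^ 'n"
    using that binary_vectors_nonneg[OF assms(2)] binary_vectors_nonneg[of k]
    by (auto simp: Icc_eq_Icc)
  then show ?thesis
    unfolding min_vertex_def cl using assms by (intro the_equality) blast+
qed

end

theory Submission
  imports Defs "HOL-Homology.Homology"
begin

text \<open>
  Let the closures of \<open>\<tau>\<close> and \<open>\<sigma>\<close> be \<open>{p..q}\<close> and \<open>{m..M}\<close>. A cube \<open>{v - j..v}\<close> of \<open>K\<close> is lost in the
  collapse iff it contains \<open>\<tau>\<close>, and freeness then puts it inside \<open>\<sigma>\<close>. So the past link at \<open>v\<close> either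
  does not change, or it loses exactly the simplices between \<open>A = {i. p $ i < v $ i}\<close> and
  \<open>B = {i. m $ i < v $ i}\<close>, where every simplex containing \<open>A\<close> lies in \<open>B\<close>.

  If \<open>m \<noteq> p\<close>, then \<open>A\<close> is a proper face of \<open>B\<close> and this is a simplicial collapse, realized by a
  straight-line deformation. If \<open>m = p\<close>, then at \<open>v = M\<close> the link loses the single maximal simplex
  \<open>B\<close>. Up to homotopy this removes the barycenter \<open>b\<close> of \<open>B\<close> from the realization \<open>X\<close>, and by
  excision \<open>H\<^sub>k(X, X - b)\<close> is infinite cyclic for \<open>k = dim B\<close> and zero otherwise. As the homology
  groups of \<open>X\<close> are noetherian, hence hopfian, the long exact sequence shows that
  \<open>H\<^sub>k(X - b) \<cong> H\<^sub>k(X)\<close> fails for \<open>k = dim B\<close> or for \<open>k = dim B - 1\<close>.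
\<close>

section \<open>Noetherian groups\<close>

text \<open>The ascending chain condition is used instead of finite generation: it passes directly
  to the middle term of an exact sequence, and one chain of kernels then gives the hopfian
  property.\<close>

definition noetherian_group :: "('a, 'b) monoid_scheme \<Rightarrow> bool" where
  "noetherian_group G \<longleftrightarrow>
     (\<forall>H :: nat \<Rightarrow> 'a set. (\<forall>n. subgroup (H n) G \<and> H n \<subseteq> H (Suc n)) \<longrightarrow> (\<exists>N. \<forall>n\<ge>N. H n = H N))"

lemma noetherian_groupD:
  fixes H :: "nat \<Rightarrow> 'a set"
  assumes "noetherian_group G" "\<And>n. subgroup (H n) G" "\<And>n. H n \<subseteq> H (Suc n)"
  shows "\<exists>N. \<forall>n\<ge>N. H n = H N"
  using assms unfolding noetherian_group_def by blast

text \<open>A chain of subgroups of \<open>B\<close> is controlled by its preimages in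
  \<open>A\<close> and its images in \<open>C\<close>: once both are stationary, so is the
  chain.\<close>

lemma noetherian_group_exact:
  fixes A :: "('a, 'x) monoid_scheme" and B :: "('b, 'y) monoid_scheme" and C :: "('c, 'z) monoid_scheme"
  assumes f: "group_hom A B f" and g: "group_hom B C g"
    and ker: "kernel B C g = f ` carrier A"
    and A: "noetherian_group A" and C: "noetherian_group C"
  shows "noetherian_group B"
  unfolding noetherian_group_def
proof (intro allI impI)
  fix H :: "nat \<Rightarrow> 'b set"
  assume H: "\<forall>n. subgroup (H n) B \<and> H n \<subseteq> H (Suc n)"
  interpret f: group_hom A B f by fact
  interpret g: group_hom B C g by fact
  have mono: "H m \<subseteq> H n" if "m \<le> n" for m n
    using H that by (meson lift_Suc_mono_le)
  have sub: "subgroup (H n) B" for n using H by blast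
  have "subgroup {x \<in> carrier A. f x \<in> H n} A" for n
    by (rule subgroup.intro) (auto simp: subgroup.m_closed[OF sub] subgroup.m_inv_closed[OF sub] subgroup.one_closed[OF sub])
  moreover have "{x \<in> carrier A. f x \<in> H n} \<subseteq> {x \<in> carrier A. f x \<in> H (Suc n)}" for n
    using H by blast
  ultimately have "\<exists>M. \<forall>n\<ge>M. {x \<in> carrier A. f x \<in> H n} = {x \<in> carrier A. f x \<in> H M}"
    by (rule noetherian_groupD[OF A])
  then obtain M where M: "\<And>n. n \<ge> M \<Longrightarrow> {x \<in> carrier A. f x \<in> H n} = {x \<in> carrier A. f x \<in> H M}"
    by blast
  have "subgroup (g ` H n) C" for n
    by (rule g.subgroup_img_is_subgroup) (rule sub)
  moreover have "g ` H n \<subseteq> g ` H (Suc n)" for n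
    using H by blast
  ultimately have "\<exists>N. \<forall>n\<ge>N. g ` H n = g ` H N"
    by (rule noetherian_groupD[OF C])
  then obtain N where N: "\<And>n. n \<ge> N \<Longrightarrow> g ` H n = g ` H N"
    by blast
  have "H n \<subseteq> H (max M N)" if n: "n \<ge> max M N" for n
  proof
    fix x assume x: "x \<in> H n"
    have "g x \<in> g ` H (max M N)"
      using N[of n] N[of "max M N"] n x by auto
    then obtain y where y: "y \<in> H (max M N)" "g x = g y" by blast
    have yn: "y \<in> H n" using y mono n by blast
    have car: "x \<in> carrier B" "y \<in> carrier B"
      using x yn sub subgroup.mem_carrier by metis+
    \<comment> \<open>\<open>x\<close> and \<open>y\<close> agree in \<open>C\<close>, so their
      quotient \<open>k\<close> comes from \<open>A\<close> by exactness. There the preimage chain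
      is stationary from \<open>M\<close> on, which moves \<open>k\<close>, and with it
      \<open>x = y k\<close>, down to stage \<open>max M N\<close>.\<close>
    define k where "k = inv\<^bsub>B\<^esub> y \<otimes>\<^bsub>B\<^esub> x"
    have kn: "k \<in> H n"
      unfolding k_def using x yn sub by (simp add: subgroup.m_closed subgroup.m_inv_closed)
    have "k \<in> kernel B C g"
      unfolding k_def kernel_def using car y by simp
    then obtain a where a: "a \<in> carrier A" "k = f a" using ker by auto
    then have "a \<in> {x \<in> carrier A. f x \<in> H (max M N)}"
      using M[of n] M[of "max M N"] n kn by auto
    then have "k \<in> H (max M N)" using a by simp
    then have "y \<otimes>\<^bsub>B\<^esub> k \<in> H (max M N)" using y sub by (simp add: subgroup.m_closed)
    also have "y \<otimes>\<^bsub>B\<^esub> k = x"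
      unfolding k_def using car by (simp add: f.H.inv_solve_left' f.H.m_assoc[symmetric])
    finally show "x \<in> H (max M N)" .
  qed
  then show "\<exists>N. \<forall>n\<ge>N. H n = H N"
    using mono by (intro exI[of _ "max M N"]) blast
qed

lemma noetherian_group_exact_seq:
  assumes "exact_seq ([C, B, A], [g, f])" "noetherian_group A" "noetherian_group C"
  shows "noetherian_group B"
  by (rule noetherian_group_exact[of A B f C g]) (use assms in \<open>auto simp: group_hom_def group_hom_axioms_def\<close>)

lemma noetherian_group_trivial:
  assumes "trivial_group G"
  shows "noetherian_group G"
proof -
  have "H = carrier G" if "subgroup H G" for H
    using assms that subgroup.one_closed subgroup.subset unfolding trivial_group_def by fastforce
  then show ?thesis
    unfolding noetherian_group_def by blast
qed

text \<open>An isomorphism is treated as the exact sequence from \<open>G\<close> to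
  \<open>H\<close> to the trivial group.\<close>

lemma noetherian_group_isomorphic:
  assumes "G \<cong> H" "group G" "group H" "noetherian_group G"
  shows "noetherian_group H"
proof -
  obtain f where f: "f \<in> iso G H" using assms by (auto simp: is_iso_def)
  then interpret f: group_hom G H f
    using assms by (simp add: group_hom_def group_hom_axioms_def iso_def)
  let ?T = "singleton_group \<one>\<^bsub>H\<^esub>"
  have t: "group_hom H ?T (\<lambda>x. \<one>\<^bsub>H\<^esub>)"
    using assms by (simp add: group_hom_def group_hom_axioms_def)
  have "kernel H ?T (\<lambda>x. \<one>\<^bsub>H\<^esub>) = f ` carrier G"
    using f by (auto simp: kernel_def singleton_group_def iso_def bij_betw_def)
  then show ?thesis
    using noetherian_group_exact[OF f.group_hom_axioms t] assms noetherian_group_trivial[of ?T] by simp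
qed

text \<open>Division with remainder: let \<open>d\<close> be the least positive integer in any
  member of the chain, say in \<open>H N\<close>. A later member contains the remainder modulo
  \<open>d\<close> of each of its elements, so by minimality it consists of multiples of
  \<open>d\<close> and lies in \<open>H N\<close>.\<close>

lemma noetherian_group_integer: "noetherian_group integer_group"
  unfolding noetherian_group_def
proof (intro allI impI)
  fix H :: "nat \<Rightarrow> int set"
  assume H: "\<forall>n. subgroup (H n) integer_group \<and> H n \<subseteq> H (Suc n)"
  have mono: "H m \<subseteq> H n" if "m \<le> n" for m n
    using H that by (meson lift_Suc_mono_le)
  have sub: "subgroup (H n) integer_group" for n using H by blast
  have add: "x + y \<in> H n" and neg: "- x \<in> H n" if "x \<in> H n" "y \<in> H n" for x y n
    using subgroup.m_closed[OF sub that] subgroup.m_inv_closed[OF sub that(1)] by auto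
  have zero: "0 \<in> H n" for n using subgroup.one_closed[OF sub[of n]] by simp
  have mult: "k * x \<in> H n" if "x \<in> H n" for k x n
  proof -
    have "int j * x \<in> H n" for j
      by (induction j) (auto simp: zero add that algebra_simps)
    then show ?thesis
      by (cases k rule: int_cases2) (use neg in auto)
  qed
  show "\<exists>N. \<forall>n\<ge>N. H n = H N"
  proof (cases "\<exists>n. \<exists>x\<in>H n. x \<noteq> 0")
    case False
    then have "H n = {0}" for n using zero by blast
    then show ?thesis by simp
  next
    case True
    then obtain n x where "x \<in> H n" "x \<noteq> 0" by blast
    then have ex: "\<exists>d n. d > 0 \<and> int d \<in> H n"
      using neg[of x n] by (intro exI[of _ "nat \<bar>x\<bar>"] exI[of _ n]) (auto simp: abs_if)
    define d where "d = (LEAST d. d > 0 \<and> (\<exists>n. int d \<in> H n))"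
    have least: "d \<le> e" if "e > 0" "int e \<in> H n" for e n
      unfolding d_def using that by (intro Least_le) (rule conjI exI | assumption)+
    have "\<exists>d. d > 0 \<and> (\<exists>n. int d \<in> H n)" using ex by simp
    then have "d > 0 \<and> (\<exists>n. int d \<in> H n)"
      unfolding d_def by (rule LeastI_ex)
    then obtain N where d: "d > 0" "int d \<in> H N" by blast
    have "H n \<subseteq> H N" if "n \<ge> N" for n
    proof
      fix x assume x: "x \<in> H n"
      have "int d \<in> H n" using d mono that by blast
      then have "x + (- (x div int d)) * int d \<in> H n"
        using add mult x by blast
      then have "int (nat (x mod int d)) \<in> H n"
        using d by (simp add: minus_div_mult_eq_mod)
      moreover have "nat (x mod int d) < d" using d by (simp add: nat_less_iff)
      ultimately have "nat (x mod int d) = 0"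
        using least[of "nat (x mod int d)" n] by linarith
      then have "x = (x div int d) * int d"
        using d pos_mod_sign[of "int d" x] div_mult_mod_eq[of x "int d"] by linarith
      then show "x \<in> H N" using mult[OF d(2)] by metis
    qed
    then show ?thesis using mono by (intro exI[of _ N]) blast
  qed
qed

text \<open>The kernels of the iterates of \<open>f\<close> ascend and become stationary at some
  \<open>N\<close>. By surjectivity an element \<open>a\<close> of the kernel of \<open>f\<close> is
  the \<open>N\<close>-th iterate of some \<open>b\<close>. Then \<open>b\<close> is killed by
  iterate \<open>N + 1\<close>, hence already by iterate \<open>N\<close>, so \<open>a\<close> is
  trivial.\<close>

lemma noetherian_group_hopfian:
  assumes noeth: "noetherian_group G" and f: "group_hom G G f" and surj: "f ` carrier G = carrier G"
  shows "inj_on f (carrier G)"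
proof -
  interpret f: group_hom G G f by fact
  define H where "H n = {x \<in> carrier G. (f ^^ n) x = \<one>\<^bsub>G\<^esub>}" for n
  have cl: "(f ^^ n) x \<in> carrier G" if "x \<in> carrier G" for x n
    using that by (induction n) auto
  have mult: "(f ^^ n) (x \<otimes>\<^bsub>G\<^esub> y) = (f ^^ n) x \<otimes>\<^bsub>G\<^esub> (f ^^ n) y" if "x \<in> carrier G" "y \<in> carrier G" for x y n
    using that by (induction n) (auto simp: cl)
  have hom: "group_hom G G (f ^^ n)" for n
    by (intro group_hom.intro group_hom_axioms.intro f.is_group homI) (auto simp: cl mult)
  have sub: "subgroup (H n) G" for n
    using group_hom.subgroup_kernel[OF hom[of n]] unfolding H_def kernel_def .
  moreover have "H n \<subseteq> H (Suc n)" for n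
    unfolding H_def by auto
  ultimately have "\<exists>N. \<forall>n\<ge>N. H n = H N"
    by (rule noetherian_groupD[OF noeth])
  then obtain N where N: "\<And>n. n \<ge> N \<Longrightarrow> H n = H N"
    by blast
  have surjn: "(f ^^ n) ` carrier G = carrier G" for n
    by (induction n) (simp_all add: surj image_comp[symmetric] del: o_apply)
  have "a = \<one>\<^bsub>G\<^esub>" if a: "a \<in> carrier G" "f a = \<one>\<^bsub>G\<^esub>" for a
  proof -
    obtain b where b: "b \<in> carrier G" "(f ^^ N) b = a" using surjn[of N] a by (metis imageE)
    then have "b \<in> H (Suc N)" using a unfolding H_def by simp
    then have "b \<in> H N" using N[of "Suc N"] by simp
    then show ?thesis using b unfolding H_def by simp
  qed
  then show ?thesis by (simp add: f.inj_on_one_iff)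
qed

text \<open>
  If \<open>Z \<rightarrow> D\<close> is injective, then \<open>D \<rightarrow> E \<cong> D\<close> is a surjective endomorphism that is not injective;
  otherwise \<open>Z \<rightarrow> D\<close> vanishes, \<open>C\<close> splits as \<open>B \<times> Z\<close>, and \<open>C \<rightarrow> B \<cong> C\<close> is such an endomorphism.
\<close>

lemma exact_seq_integer_group_not_isomorphic:
  assumes ex: "exact_seq ([E, D, Z, C, B], [j, b, q, i])"
    and inj: "inj_on i (carrier B)" and surj: "j ` carrier D = carrier E"
    and Z: "Z \<cong> integer_group" and C: "comm_group C"
    and nC: "noetherian_group C" and nD: "noetherian_group D"
    and BC: "B \<cong> C" and DE: "D \<cong> E"
  shows False
proof -
  interpret j: group_hom D E j using ex by (auto simp: group_hom_def group_hom_axioms_def)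
  interpret b: group_hom Z D b using ex by (auto simp: group_hom_def group_hom_axioms_def)
  interpret q: group_hom C Z q using ex by (auto simp: group_hom_def group_hom_axioms_def)
  interpret i: group_hom B C i using ex by (auto simp: group_hom_def group_hom_axioms_def)
  interpret C: comm_group C by fact
  have kj: "kernel D E j = b ` carrier Z" and kb: "kernel Z D b = q ` carrier C"
    and kq: "kernel C Z q = i ` carrier B"
    using ex by auto
  obtain h where h: "h \<in> iso E D"
    using DE group.iso_sym[OF j.G.is_group] by (auto simp: is_iso_def)
  have hj: "group_hom D D (h \<circ> j)"
    using h by (intro group_hom.intro group_hom_axioms.intro j.G.is_group hom_compose[OF j.homh]) (simp add: iso_def)
  have "(h \<circ> j) ` carrier D = carrier D"
    using h surj unfolding image_comp[symmetric] by (simp add: iso_def bij_betw_def)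
  then have "inj_on (h \<circ> j) (carrier D)"
    by (rule noetherian_group_hopfian[OF nD hj])
  then have "inj_on j (carrier D)" by (rule inj_on_imageI2)
  \<comment> \<open>Exactness at \<open>D\<close> now makes \<open>b\<close> trivial, and exactness
    at \<open>Z\<close> makes \<open>q\<close> surjective.\<close>
  then have "kernel D E j = {\<one>\<^bsub>D\<^esub>}" by (simp add: j.inj_iff_trivial_ker)
  then have qsurj: "q ` carrier C = carrier Z"
    using kj kb by (auto simp: kernel_def)
  obtain z where z: "z \<in> iso Z integer_group" using Z by (auto simp: is_iso_def)
  define w where "w = z \<circ> q"
  have w: "w \<in> hom C integer_group"
    unfolding w_def using z by (intro hom_compose[OF q.homh]) (simp add: iso_def)
  interpret w: group_hom C integer_group w
    using w by (intro group_hom.intro group_hom_axioms.intro) auto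
  have z0: "z y = 0 \<longleftrightarrow> y = \<one>\<^bsub>Z\<^esub>" if "y \<in> carrier Z" for y
  proof -
    interpret z: group_hom Z integer_group z
      using z by (intro group_hom.intro group_hom_axioms.intro b.is_group) (auto simp: iso_def)
    show ?thesis
      using z that z.hom_one z.inj_on_one_iff by (auto simp: iso_def bij_betw_def)
  qed
  have wi: "w x = 0 \<longleftrightarrow> x \<in> i ` carrier B" if "x \<in> carrier C" for x
    using kq[symmetric] that by (simp add: w_def z0 kernel_def)
  obtain s where s: "s \<in> carrier C" "w s = 1"
  proof -
    have "w ` carrier C = UNIV"
      using z qsurj unfolding w_def image_comp[symmetric] by (simp add: iso_def bij_betw_def)
    then show ?thesis using that by (metis UNIV_I imageE)
  qed
  \<comment> \<open>The preimage \<open>s\<close> of the generator splits \<open>w\<close>;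
    \<open>e\<close> projects \<open>C\<close> onto the kernel of \<open>w\<close>, the image of
    \<open>B\<close>, along the subgroup generated by \<open>s\<close>.\<close>
  define e where "e c = c \<otimes>\<^bsub>C\<^esub> inv\<^bsub>C\<^esub> (s [^]\<^bsub>C\<^esub> w c)" for c
  have ec: "e c \<in> carrier C" if "c \<in> carrier C" for c
    using that s by (simp add: e_def)
  have emult: "e (c \<otimes>\<^bsub>C\<^esub> d) = e c \<otimes>\<^bsub>C\<^esub> e d" if "c \<in> carrier C" "d \<in> carrier C" for c d
    using that s by (simp add: e_def group.int_pow_mult[OF comm_group.axioms(2)[OF C]] C.inv_mult C.m_ac)
  have wpow: "w (s [^]\<^bsub>C\<^esub> n) = n" for n :: int
    using s by (simp add: w.hom_int_pow)
  have eB: "e c \<in> i ` carrier B" if c: "c \<in> carrier C" for c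
    using c s wi[of "e c"] ec[OF c] wpow by (simp add: e_def)
  define g where "g c = inv_into (carrier B) i (e c)" for c
  have g: "g c \<in> carrier B" "i (g c) = e c" if "c \<in> carrier C" for c
    using eB[OF that] unfolding g_def by (auto simp: inv_into_into f_inv_into_f)
  have ghom: "g \<in> hom C B"
  proof (rule homI)
    fix x y assume xy: "x \<in> carrier C" "y \<in> carrier C"
    then have "i (g (x \<otimes>\<^bsub>C\<^esub> y)) = i (g x \<otimes>\<^bsub>B\<^esub> g y)"
      by (simp add: g emult)
    then show "g (x \<otimes>\<^bsub>C\<^esub> y) = g x \<otimes>\<^bsub>B\<^esub> g y"
      using inj_onD[OF inj] xy g by simp
  qed (use g in auto)
  have gsurj: "g ` carrier C = carrier B"
  proof (intro equalityI subsetI)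
    fix x assume x: "x \<in> carrier B"
    have "w (i x) = 0" using wi[of "i x"] x by simp
    then have "e (i x) = i x" using x by (simp add: e_def)
    then have "g (i x) = x" unfolding g_def using inj x by simp
    then show "x \<in> g ` carrier C" using x by (metis i.hom_closed imageI)
  qed (use g in auto)
  obtain k where k: "k \<in> iso B C" using BC by (auto simp: is_iso_def)
  have kg: "group_hom C C (k \<circ> g)"
    using k by (intro group_hom.intro group_hom_axioms.intro comm_group.axioms(2)[OF C] hom_compose[OF ghom]) (simp add: iso_def)
  have "(k \<circ> g) ` carrier C = carrier C"
    using k gsurj unfolding image_comp[symmetric] by (simp add: iso_def bij_betw_def)
  then have "inj_on (k \<circ> g) (carrier C)"
    by (rule noetherian_group_hopfian[OF nC kg])
  then have gi: "inj_on g (carrier C)" by (rule inj_on_imageI2)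
  \<comment> \<open>The projection kills \<open>s\<close>, so injectivity of \<open>g\<close> would
    make \<open>s\<close> trivial, although \<open>w s = 1\<close>.\<close>
  have "e s = e \<one>\<^bsub>C\<^esub>" using s w.hom_one by (simp add: e_def)
  then have "g s = g \<one>\<^bsub>C\<^esub>" by (simp add: g_def)
  then have "s = \<one>\<^bsub>C\<^esub>" using gi s by (auto dest: inj_onD)
  then show False using s w.hom_one by simp
qed

section \<open>Realizations of simplicial complexes\<close>

text \<open>The segment condition has an explicit parameter \<open>c\<close> because in both
  applications \<open>r x - x\<close> is a multiple of a direction vector, so a partial move is a
  move of the same kind with a smaller coefficient.\<close>

lemma straight_line_homotopy_eqv:
  fixes S :: "'a::euclidean_space set"
  assumes "T \<subseteq> S" and cont: "continuous_on S r"
    and im: "\<And>x. x \<in> S \<Longrightarrow> r x \<in> T" and id: "\<And>x. x \<in> T \<Longrightarrow> r x = x"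
    and seg: "\<And>x c. x \<in> S \<Longrightarrow> 0 \<le> c \<Longrightarrow> c \<le> 1 \<Longrightarrow> x + c *\<^sub>R (r x - x) \<in> S"
  shows "S homotopy_eqv T"
proof (rule deformation_retract_imp_homotopy_eqv)
  show "homotopic_with_canon (\<lambda>x. True) S S id r"
  proof (rule homotopic_with_linear)
    fix x assume x: "x \<in> S"
    show "closed_segment (id x) (r x) \<subseteq> S"
    proof
      fix y assume "y \<in> closed_segment (id x) (r x)"
      then obtain u where "0 \<le> u" "u \<le> 1" "y = x + u *\<^sub>R (r x - x)"
        by (auto simp: closed_segment_def algebra_simps)
      then show "y \<in> S" using seg[OF x] by blast
    qed
  qed (use cont in auto)
  show "retraction S T r"
    using assms by (auto simp: retraction_def)
qed

lemma continuous_on_Min_image: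
  fixes f :: "'i \<Rightarrow> 'a::topological_space \<Rightarrow> 'b::linorder_topology"
  assumes "finite A" "A \<noteq> {}" "\<And>i. i \<in> A \<Longrightarrow> continuous_on X (f i)"
  shows "continuous_on X (\<lambda>x. Min ((\<lambda>i. f i x) ` A))"
  using assms by (induction A rule: finite_ne_induct) (auto intro: continuous_on_min)

text \<open>Simplices are nonempty, in accordance with past links, which omit the zero vector. The
  empty complex is allowed and has empty realization.\<close>

definition abstract_simplicial_complex :: "'v set set \<Rightarrow> bool" where
  "abstract_simplicial_complex S \<longleftrightarrow> (\<forall>s\<in>S. s \<noteq> {} \<and> (\<forall>t. t \<noteq> {} \<and> t \<subseteq> s \<longrightarrow> t \<in> S))"

lemma abstract_simplicial_complexD:
  assumes "abstract_simplicial_complex S" "s \<in> S"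
  shows "s \<noteq> {}" "\<And>t. t \<noteq> {} \<Longrightarrow> t \<subseteq> s \<Longrightarrow> t \<in> S"
  using assms unfolding abstract_simplicial_complex_def by blast+

lemma abstract_simplicial_complex_delete:
  assumes "abstract_simplicial_complex S"
  shows "abstract_simplicial_complex {s \<in> S. \<not> A \<subseteq> s}"
  using assms unfolding abstract_simplicial_complex_def by blast

lemma abstract_simplicial_complex_remove_maximal:
  assumes "abstract_simplicial_complex S" "\<forall>s\<in>S. B \<subseteq> s \<longrightarrow> s = B"
  shows "abstract_simplicial_complex (S - {B})"
  using assms unfolding abstract_simplicial_complex_def by (metis DiffD1 DiffI singletonD)

text \<open>These are barycentric coordinates. The right-hand side is convex and contains the
  vertices; conversely a point is the combination of unit vectors weighted by its own
  coordinates.\<close>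

lemma convex_hull_axis:
  fixes s :: "'n::finite set"
  shows "convex hull ((\<lambda>i. axis i 1) ` s) =
    {x :: real ^ 'n. (\<forall>i. 0 \<le> x $ i) \<and> (\<Sum>i\<in>UNIV. x $ i) = 1 \<and> {i. x $ i \<noteq> 0} \<subseteq> s}" (is "?L = ?R")
proof
  show "?L \<subseteq> ?R"
  proof (rule hull_minimal)
    show "(\<lambda>i. axis i 1) ` s \<subseteq> ?R" by (auto simp: axis_def split: if_splits)
    show "convex ?R"
      unfolding convex_def
    proof (intro ballI allI impI)
      fix x y :: "real ^ 'n" and u v :: real
      assume x: "x \<in> ?R" and y: "y \<in> ?R" and uv: "0 \<le> u" "0 \<le> v" "u + v = 1"
      have "(\<Sum>i\<in>UNIV. (u *\<^sub>R x + v *\<^sub>R y) $ i) = u * (\<Sum>i\<in>UNIV. x $ i) + v * (\<Sum>i\<in>UNIV. y $ i)"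
        by (simp add: sum.distrib sum_distrib_left)
      moreover have "{i. (u *\<^sub>R x + v *\<^sub>R y) $ i \<noteq> 0} \<subseteq> {i. x $ i \<noteq> 0} \<union> {i. y $ i \<noteq> 0}"
        by auto
      ultimately show "u *\<^sub>R x + v *\<^sub>R y \<in> ?R"
        using x y uv by auto
    qed
  qed
  show "?R \<subseteq> ?L"
  proof
    fix x assume x: "x \<in> ?R"
    have "(\<Sum>i\<in>s. x $ i) = (\<Sum>i\<in>UNIV. x $ i)"
      using x by (intro sum.mono_neutral_left) auto
    then have "(\<Sum>i\<in>s. x $ i *\<^sub>R axis i 1) \<in> ?L"
      using x by (intro convex_sum) (auto intro: hull_inc)
    also have "(\<Sum>i\<in>s. x $ i *\<^sub>R axis i 1) = (\<Sum>i\<in>UNIV. x $ i *\<^sub>R (axis i 1 :: real ^ 'n))"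
      using x by (intro sum.mono_neutral_left) auto
    also have "\<dots> = x"
      using basis_expansion[of x] by (simp add: scalar_mult_eq_scaleR)
    finally show "x \<in> ?L" .
  qed
qed

text \<open>Closure under nonempty faces lets the support of a point decide membership, so the
  deformations below can be checked coordinate by coordinate.\<close>

lemma geometric_realization_iff:
  fixes S :: "'n::finite set set"
  assumes "abstract_simplicial_complex S"
  shows "x \<in> geometric_realization S \<longleftrightarrow>
    (\<forall>i. 0 \<le> x $ i) \<and> (\<Sum>i\<in>UNIV. x $ i) = 1 \<and> {i. x $ i \<noteq> 0} \<in> S" (is "?L \<longleftrightarrow> ?R")
proof
  assume ?L
  then obtain s where s: "s \<in> S" "\<forall>i. 0 \<le> x $ i" "(\<Sum>i\<in>UNIV. x $ i) = 1" "{i. x $ i \<noteq> 0} \<subseteq> s"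
    unfolding geometric_realization_def convex_hull_axis by blast
  have "{i. x $ i \<noteq> 0} \<noteq> {}"
  proof
    assume "{i. x $ i \<noteq> 0} = {}"
    then have "(\<Sum>i\<in>UNIV. x $ i) = 0" by (intro sum.neutral) auto
    then show False using s(3) by simp
  qed
  then show ?R using s abstract_simplicial_complexD(2)[OF assms s(1)] by simp
next
  assume ?R
  then show ?L unfolding geometric_realization_def convex_hull_axis by blast
qed

lemma geometric_realizationI:
  fixes S :: "'n::finite set set"
  assumes "abstract_simplicial_complex S" "s \<in> S" "\<And>i. 0 \<le> x $ i" "(\<Sum>i\<in>UNIV. x $ i) = 1" "\<And>i. i \<notin> s \<Longrightarrow> x $ i = 0"
  shows "x \<in> geometric_realization S"
  using assms unfolding geometric_realization_def convex_hull_axis by blast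

lemma geometric_realization_mono:
  "S \<subseteq> T \<Longrightarrow> geometric_realization S \<subseteq> geometric_realization T"
  unfolding geometric_realization_def by blast

lemma sum_indicator_vec:
  fixes A :: "'n::finite set"
  shows "(\<Sum>i\<in>UNIV. (if i \<in> A then c else 0)) = real (card A) * c"
  by (simp add: sum.If_cases)

text \<open>
  With \<open>t\<close> the minimum of the \<open>A\<close>-coordinates, the deformation takes the mass \<open>t\<close> off every vertex
  in \<open>A\<close> and puts it on \<open>b\<close>. It moves only points whose support contains \<open>A\<close>.
\<close>

lemma geometric_realization_collapse:
  fixes S :: "'n::finite set set"
  assumes S: "abstract_simplicial_complex S" and A: "A \<noteq> {}" "A \<subseteq> B" and B: "B \<in> S" and b: "b \<in> B" "b \<notin> A"
    and free: "\<And>s. s \<in> S \<Longrightarrow> A \<subseteq> s \<Longrightarrow> s \<subseteq> B"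
  shows "geometric_realization S homotopy_eqv geometric_realization {s \<in> S. \<not> A \<subseteq> s}"
proof -
  define t where "t x = Min ((\<lambda>i. x $ i) ` A)" for x :: "real ^ 'n"
  define w :: "real ^ 'n" where "w = (\<chi> i. (if i = b then real (card A) else 0) - (if i \<in> A then 1 else 0))"
  note S' = abstract_simplicial_complex_delete[OF S, of A]
  have tle: "t x \<le> x $ i" if "i \<in> A" for x i
    unfolding t_def using that by simp
  have tex: "\<exists>i\<in>A. x $ i = t x" for x
  proof -
    have "t x \<in> (\<lambda>i. x $ i) ` A" unfolding t_def using A by (intro Min_in) auto
    then show ?thesis by force
  qed
  have w_nth: "w $ i = (if i = b then real (card A) else 0) - (if i \<in> A then 1 else 0)" for i
    by (simp add: w_def)
  have wsum: "(\<Sum>i\<in>UNIV. w $ i) = 0"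
    by (simp add: w_nth sum_subtractf sum_indicator_vec)
  \<comment> \<open>If \<open>t x > 0\<close>, the support of \<open>x\<close> contains
    \<open>A\<close>, so freeness puts it inside \<open>B\<close>. The whole move then stays in the
    simplex \<open>B\<close>, and \<open>c \<le> t x\<close> keeps the coordinates in
    \<open>A\<close> nonnegative.\<close>
  have move: "x + c *\<^sub>R w \<in> geometric_realization S"
    if x: "x \<in> geometric_realization S" and c: "0 \<le> c" "c \<le> t x" for x c
  proof (cases "t x = 0")
    case True
    then show ?thesis using c x by simp
  next
    case False
    then have t: "t x > 0" using c by simp
    have xx: "\<forall>i. 0 \<le> x $ i" "(\<Sum>i\<in>UNIV. x $ i) = 1" "{i. x $ i \<noteq> 0} \<in> S"
      using x by (auto simp: geometric_realization_iff[OF S])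
    have "A \<subseteq> {i. x $ i \<noteq> 0}" using t tle by (smt (verit) mem_Collect_eq subsetI)
    then have sub: "{i. x $ i \<noteq> 0} \<subseteq> B" using free xx by blast
    show ?thesis
    proof (rule geometric_realizationI[OF S B])
      show "0 \<le> (x + c *\<^sub>R w) $ i" for i
      proof (cases "i \<in> A")
        case True
        then show ?thesis using tle[of i x] c b by (auto simp: w_nth)
      next
        case False
        then show ?thesis using xx c by (simp add: w_nth)
      qed
      show "(\<Sum>i\<in>UNIV. (x + c *\<^sub>R w) $ i) = 1"
        using xx wsum by (simp add: sum.distrib sum_distrib_left[symmetric])
      show "(x + c *\<^sub>R w) $ i = 0" if "i \<notin> B" for i
        using that sub b A by (auto simp: w_nth)
    qed
  qed
  have t0: "0 \<le> t x" if "x \<in> geometric_realization S" for x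
    using that tex[of x] unfolding geometric_realization_iff[OF S] by metis
  show ?thesis
  proof (rule straight_line_homotopy_eqv)
    show "geometric_realization {s \<in> S. \<not> A \<subseteq> s} \<subseteq> geometric_realization S"
      by (rule geometric_realization_mono) blast
    show "continuous_on (geometric_realization S) (\<lambda>x. x + t x *\<^sub>R w)"
      unfolding t_def by (intro continuous_intros continuous_on_Min_image A) auto
    show "x + t x *\<^sub>R w \<in> geometric_realization {s \<in> S. \<not> A \<subseteq> s}" if x: "x \<in> geometric_realization S" for x
    proof -
      obtain i where i: "i \<in> A" "x $ i = t x" using tex by blast
      \<comment> \<open>The coordinate that attains the minimum drops to zero, so the support of the
        image no longer contains \<open>A\<close>.\<close>
      then have "(x + t x *\<^sub>R w) $ i = 0" using b by (auto simp: w_nth)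
      then show ?thesis
        using move[OF x t0[OF x] order_refl] i
        unfolding geometric_realization_iff[OF S] geometric_realization_iff[OF S'] by blast
    qed
    show "x + t x *\<^sub>R w = x" if x: "x \<in> geometric_realization {s \<in> S. \<not> A \<subseteq> s}" for x
    proof -
      obtain i where i: "i \<in> A" "x $ i = 0" "0 \<le> t x"
        using x t0[of x] by (auto simp: geometric_realization_iff[OF S'] geometric_realization_iff[OF S])
      then show ?thesis using tle[of i x] by simp
    qed
    show "x + c *\<^sub>R (x + t x *\<^sub>R w - x) \<in> geometric_realization S"
      if "x \<in> geometric_realization S" "0 \<le> c" "c \<le> 1" for x c
      using move[of x "c * t x"] that t0[of x] by (simp add: mult_left_le_one_le)
  qed
qed

section \<open>Puncturing a maximal simplex at its barycenter\<close>

definition barycenter :: "'n::finite set \<Rightarrow> real ^ 'n" where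
  "barycenter B = (\<chi> i. if i \<in> B then 1 / real (card B) else 0)"

text \<open>The coordinates of \<open>x - barycenter B\<close> are nonnegative and sum to
  zero.\<close>

lemma barycenter_unique:
  assumes B: "B \<noteq> {}" and x: "\<And>i. 0 \<le> x $ i" "(\<Sum>i\<in>UNIV. x $ i) = 1"
    and ge: "\<And>i. i \<in> B \<Longrightarrow> 1 / real (card B) \<le> x $ i"
  shows "x = barycenter B"
proof -
  have "(\<Sum>i\<in>UNIV. (x - barycenter B) $ i) = 0"
    using B x(2) by (simp add: barycenter_def sum_subtractf sum_indicator_vec)
  moreover have "0 \<le> (x - barycenter B) $ i" for i
    using x ge by (simp add: barycenter_def)
  ultimately have "(x - barycenter B) $ i = 0" for i
    by (simp add: sum_nonneg_eq_0_iff)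
  then show ?thesis by (simp add: vec_eq_iff)
qed

text \<open>
  With \<open>t\<close> the minimum of the \<open>B\<close>-coordinates and \<open>k = card B\<close>, a point \<open>x\<close> is sent to
  \<open>(x - t *\<^sub>R 1\<^sub>B) /\<^sub>R (1 - k * t)\<close>, which is the projection away from the barycenter; in the proof it
  has the form \<open>x + (t / (1 - k * t)) *\<^sub>R (k *\<^sub>R x - 1\<^sub>B)\<close>.
\<close>

lemma geometric_realization_puncture:
  fixes S :: "'n::finite set set"
  assumes S: "abstract_simplicial_complex S" and B: "B \<in> S" and max: "\<forall>s\<in>S. B \<subseteq> s \<longrightarrow> s = B"
  shows "(geometric_realization S - {barycenter B}) homotopy_eqv geometric_realization (S - {B})"
proof -
  define k where "k = real (card B)"
  define t where "t x = Min ((\<lambda>i. x $ i) ` B)" for x :: "real ^ 'n"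
  define w :: "real ^ 'n \<Rightarrow> real ^ 'n" where "w x = (\<chi> i. k * x $ i - (if i \<in> B then 1 else 0))" for x
  have Bne: "B \<noteq> {}" using abstract_simplicial_complexD[OF S B] by blast
  then have k: "k > 0" unfolding k_def by (simp add: card_gt_0_iff)
  note S' = abstract_simplicial_complex_remove_maximal[OF S max]
  have tle: "t x \<le> x $ i" if "i \<in> B" for x i
    unfolding t_def using that by simp
  have tex: "\<exists>i\<in>B. x $ i = t x" for x
  proof -
    have "t x \<in> (\<lambda>i. x $ i) ` B" unfolding t_def using Bne by (intro Min_in) auto
    then show ?thesis by force
  qed
  have w_nth: "w x $ i = k * x $ i - (if i \<in> B then 1 else 0)" for x i
    by (simp add: w_def)
  have t0: "0 \<le> t x" if "x \<in> geometric_realization S" for x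
    using that tex[of x] unfolding geometric_realization_iff[OF S] by metis
  \<comment> \<open>The denominator of the projection can fail to be positive only if all
    \<open>B\<close>-coordinates are at least \<open>1 / k\<close>, which forces the
    barycenter.\<close>
  have t1: "0 < 1 - k * t x" if x: "x \<in> geometric_realization S - {barycenter B}" for x
  proof (rule ccontr)
    assume "\<not> 0 < 1 - k * t x"
    then have "1 / k \<le> t x" using k by (simp add: field_simps)
    then have "1 / k \<le> x $ i" if "i \<in> B" for i using tle[OF that, of x] by simp
    then have "x = barycenter B"
      using x Bne by (intro barycenter_unique) (auto simp: geometric_realization_iff[OF S] k_def)
    then show False using x by simp
  qed
  \<comment> \<open>At coefficient \<open>c0 x\<close> the smallest \<open>B\<close>-coordinate
    reaches zero: the solution of \<open>t x + c * (k * t x - 1) = 0\<close>.\<close>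
  define c0 where "c0 x = t x / (1 - k * t x)" for x
  have c0: "0 \<le> c0 x" if "x \<in> geometric_realization S - {barycenter B}" for x
    unfolding c0_def using t0[of x] t1[OF that] that by simp
  have coord: "0 \<le> x $ i + c * (k * x $ i - 1)"
    if x: "x \<in> geometric_realization S - {barycenter B}" and c: "0 \<le> c" "c \<le> c0 x" and i: "i \<in> B" for x c i
  proof -
    have "c * (1 - k * t x) \<le> t x"
      using c t1[OF x] unfolding c0_def by (simp add: pos_le_divide_eq)
    also have "t x + c * (k * t x) \<le> x $ i + c * (k * x $ i)"
      using tle[OF i, of x] c k by (intro add_mono mult_left_mono) auto
    ultimately show ?thesis by (simp add: algebra_simps)
  qed
  have move: "x + c *\<^sub>R w x \<in> geometric_realization S"
    if x: "x \<in> geometric_realization S - {barycenter B}" and c: "0 \<le> c" "c \<le> c0 x" for x c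
  proof (cases "t x = 0")
    case True
    then have "c = 0" using c by (simp add: c0_def)
    then show ?thesis using x by simp
  next
    case False
    then have t: "t x > 0" using t0[of x] x by simp
    have xx: "\<forall>i. 0 \<le> x $ i" "(\<Sum>i\<in>UNIV. x $ i) = 1" "{i. x $ i \<noteq> 0} \<in> S"
      using x by (auto simp: geometric_realization_iff[OF S])
    have "B \<subseteq> {i. x $ i \<noteq> 0}" using t tle by (smt (verit) mem_Collect_eq subsetI)
    then have sub: "{i. x $ i \<noteq> 0} = B" using max xx by blast
    show ?thesis
    proof (rule geometric_realizationI[OF S B])
      show "0 \<le> (x + c *\<^sub>R w x) $ i" for i
        using coord[OF x c, of i] xx sub by (cases "i \<in> B") (auto simp: w_nth)
      have "(\<Sum>i\<in>UNIV. (x + c *\<^sub>R w x) $ i) = (\<Sum>i\<in>UNIV. x $ i) + c * (k * (\<Sum>i\<in>UNIV. x $ i) - k)"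
        by (simp add: sum.distrib w_nth sum_subtractf sum_distrib_left[symmetric] sum_indicator_vec k_def)
      then show "(\<Sum>i\<in>UNIV. (x + c *\<^sub>R w x) $ i) = 1" using xx by simp
      show "(x + c *\<^sub>R w x) $ i = 0" if "i \<notin> B" for i
        using that sub by (auto simp: w_nth)
    qed
  qed
  \<comment> \<open>Moving away from the barycenter never meets it: at the smallest
    \<open>B\<close>-coordinate equality would give \<open>(1 - k * t x) * (1 + k * c) = 0\<close>,
    but both factors are positive.\<close>
  have avoid: "x + c *\<^sub>R w x \<noteq> barycenter B"
    if x: "x \<in> geometric_realization S - {barycenter B}" and c: "0 \<le> c" for x c
  proof
    assume eq: "x + c *\<^sub>R w x = barycenter B"
    obtain i where i: "i \<in> B" "x $ i = t x" using tex by blast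
    have "(x + c *\<^sub>R w x) $ i = 1 / k" using i by (simp add: eq barycenter_def k_def)
    then have "k * (t x + c * (k * t x - 1)) = 1" using i k by (simp add: w_nth field_simps)
    then have "(1 - k * t x) * (1 + k * c) = 0" by (simp add: algebra_simps)
    then show False using t1[OF x] c k by (smt (verit) mult_eq_0_iff mult_nonneg_nonneg)
  qed
  show ?thesis
  proof (rule straight_line_homotopy_eqv)
    have b: "barycenter B \<notin> geometric_realization (S - {B})"
    proof -
      have "{i. barycenter B $ i \<noteq> 0} = B" using Bne by (auto simp: barycenter_def)
      then show ?thesis by (simp add: geometric_realization_iff[OF S'])
    qed
    show sub: "geometric_realization (S - {B}) \<subseteq> geometric_realization S - {barycenter B}"
      using b geometric_realization_mono[of "S - {B}" S] by blast
    show "continuous_on (geometric_realization S - {barycenter B}) (\<lambda>x. x + c0 x *\<^sub>R w x)"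
      unfolding c0_def w_def
    proof (intro continuous_intros)
      show "continuous_on (geometric_realization S - {barycenter B}) t"
        unfolding t_def by (intro continuous_intros continuous_on_Min_image Bne) auto
      then show "continuous_on (geometric_realization S - {barycenter B}) t" .
      show "\<forall>x\<in>geometric_realization S - {barycenter B}. 1 - k * t x \<noteq> 0"
        using t1 by fastforce
    qed
    show "x + c0 x *\<^sub>R w x \<in> geometric_realization (S - {B})"
      if x: "x \<in> geometric_realization S - {barycenter B}" for x
    proof -
      obtain i where i: "i \<in> B" "x $ i = t x" using tex by blast
      have "t x + c0 x * (k * t x - 1) = 0"
        using t1[OF x] by (simp add: c0_def field_simps)
      then have "(x + c0 x *\<^sub>R w x) $ i = 0" using i by (simp add: w_nth)
      then have "{i. (x + c0 x *\<^sub>R w x) $ i \<noteq> 0} \<noteq> B" using i by blast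
      then show ?thesis
        using move[OF x c0[OF x] order_refl]
        unfolding geometric_realization_iff[OF S] geometric_realization_iff[OF S'] by simp
    qed
    show "x + c0 x *\<^sub>R w x = x" if x: "x \<in> geometric_realization (S - {B})" for x
    proof -
      have "\<not> B \<subseteq> {i. x $ i \<noteq> 0}"
        using x max unfolding geometric_realization_iff[OF S'] by blast
      then obtain i where i: "i \<in> B" "x $ i = 0" by blast
      have "0 \<le> t x" using t0[of x] sub x by blast
      then have "t x = 0" using tle[of i x] i by simp
      then show ?thesis by (simp add: c0_def)
    qed
    show "x + c *\<^sub>R (x + c0 x *\<^sub>R w x - x) \<in> geometric_realization S - {barycenter B}"
      if "x \<in> geometric_realization S - {barycenter B}" "0 \<le> c" "c \<le> 1" for x c
      using move[of x "c * c0 x"] avoid[of x "c * c0 x"] that c0[of x] by (simp add: mult_left_le_one_le)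
  qed
qed

text \<open>Every simplex \<open>s\<close> is a face of \<open>insert a s\<close>, which contains
  all segments from the apex to points of \<open>s\<close>; the realization is therefore
  starlike.\<close>

lemma contractible_geometric_realization_cone:
  fixes S :: "'n::finite set set"
  assumes S: "abstract_simplicial_complex S" and a: "{a} \<in> S" and cone: "\<And>s. s \<in> S \<Longrightarrow> insert a s \<in> S"
  shows "contractible (geometric_realization S)"
proof -
  have "axis a 1 \<in> geometric_realization S"
    by (rule geometric_realizationI[OF S a]) (auto simp: axis_def)
  moreover have "closed_segment (axis a 1) x \<subseteq> geometric_realization S" if x: "x \<in> geometric_realization S" for x
  proof -
    obtain s where s: "s \<in> S" "x \<in> convex hull ((\<lambda>i. axis i 1) ` s)"
      using x unfolding geometric_realization_def by blast
    have "x \<in> convex hull ((\<lambda>i. axis i 1) ` insert a s)"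
      using s(2) hull_mono[of "(\<lambda>i. axis i 1) ` s" "(\<lambda>i. axis i 1) ` insert a s"] by blast
    moreover have "axis a 1 \<in> convex hull ((\<lambda>i. axis i (1::real)) ` insert a s)"
      by (rule hull_inc) simp
    ultimately have "closed_segment (axis a 1) x \<subseteq> convex hull ((\<lambda>i. axis i 1) ` insert a s)"
      by (intro closed_segment_subset convex_convex_hull)
    then show ?thesis
      using cone[OF s(1)] unfolding geometric_realization_def by blast
  qed
  ultimately have "starlike (geometric_realization S)"
    unfolding starlike_def by blast
  then show ?thesis by (rule starlike_imp_contractible)
qed

section \<open>Homology of realizations\<close>

lemma abstract_simplicial_complex_Pow: "abstract_simplicial_complex (Pow B - {{}})"
  unfolding abstract_simplicial_complex_def by auto

text \<open>Excision of everything outside the closed simplex \<open>B\<close>: the local homology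
  at the barycenter sees only that simplex.\<close>

lemma local_homology_maximal_simplex:
  fixes S :: "'n::finite set set"
  assumes S: "abstract_simplicial_complex S" and B: "B \<in> S" and max: "\<forall>s\<in>S. B \<subseteq> s \<longrightarrow> s = B"
  shows "relative_homology_group p (top_of_set (geometric_realization (Pow B - {{}})))
           (geometric_realization (Pow B - {{}}) - {barycenter B}) \<cong>
         relative_homology_group p (top_of_set (geometric_realization S))
           (geometric_realization S - {barycenter B})"
proof -
  let ?X = "geometric_realization S" and ?D = "geometric_realization (Pow B - {{}})"
  let ?top = "top_of_set ?X"
  have Bne: "B \<noteq> {}" using abstract_simplicial_complexD[OF S B] by blast
  note P = abstract_simplicial_complex_Pow[of B]
  have DX: "?D \<subseteq> ?X"
    using abstract_simplicial_complexD(2)[OF S B] by (intro geometric_realization_mono) auto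
  define U where "U = ?X - ?D"
  \<comment> \<open>A closed set separating \<open>U\<close> from the barycenter, as excision
    requires. By maximality of \<open>B\<close>, a point outside the closed simplex misses some
    vertex of \<open>B\<close>, whereas all \<open>B\<close>-coordinates of the barycenter are
    positive.\<close>
  define C where "C = ?X \<inter> (\<Union>i\<in>B. {x. x $ i = 0})"
  have "U \<subseteq> C"
  proof
    fix x assume x: "x \<in> U"
    then have xx: "\<forall>i. 0 \<le> x $ i" "(\<Sum>i\<in>UNIV. x $ i) = 1" "{i. x $ i \<noteq> 0} \<in> S"
      by (simp_all add: U_def geometric_realization_iff[OF S])
    have "{i. x $ i \<noteq> 0} \<notin> Pow B - {{}}"
    proof
      assume "{i. x $ i \<noteq> 0} \<in> Pow B - {{}}"
      then have "x \<in> ?D" unfolding geometric_realization_iff[OF P] using xx(1,2) by (intro conjI)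
      then show False using x by (simp add: U_def)
    qed
    then have "{i. x $ i \<noteq> 0} \<noteq> B" using Bne by auto
    then have "\<not> B \<subseteq> {i. x $ i \<noteq> 0}" using max xx(3) by blast
    then show "x \<in> C" using x unfolding C_def U_def by blast
  qed
  moreover have "closedin ?top C"
    unfolding C_def by (intro closedin_closed_Int closed_UN) (auto intro!: closed_Collect_eq continuous_intros)
  ultimately have "?top closure_of U \<subseteq> C"
    by (rule closure_of_minimal)
  also have "C \<subseteq> ?X - {barycenter B}"
    unfolding C_def by (auto simp: barycenter_def)
  also have "\<dots> = ?top interior_of (?X - {barycenter B})"
    by (rule interior_of_openin[symmetric]) (simp add: openin_delete)
  finally have "relative_homology_group p (subtopology ?top (?X - U)) ((?X - {barycenter B}) - U) \<cong>
      relative_homology_group p (subtopology ?top ?X) (?X - {barycenter B})"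
    by (intro is_isoI[OF homology_excision_axiom]) auto
  moreover have "?X - U = ?D" "(?X - {barycenter B}) - U = ?D - {barycenter B}"
    using DX unfolding U_def by blast+
  ultimately show ?thesis
    using DX by (simp add: subtopology_subtopology Int_absorb1)
qed

lemma barycenter_in_geometric_realization:
  "B \<noteq> {} \<Longrightarrow> barycenter B \<in> geometric_realization (Pow B - {{}})"
  by (rule geometric_realizationI[OF abstract_simplicial_complex_Pow, of B])
    (auto simp: barycenter_def sum_indicator_vec)

text \<open>
  Induction on the simplex: the boundary of \<open>insert a F\<close> minus its facet \<open>F\<close> is a cone with apex \<open>a\<close>,
  so the reduced homology of that boundary is its local homology at the barycenter of \<open>F\<close>.
\<close>

lemma relative_homology_punctured_simplex:
  fixes B :: "'n::finite set"
  assumes "B \<noteq> {}"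
  shows "(p = int (card B) - 1 \<longrightarrow>
      relative_homology_group p (top_of_set (geometric_realization (Pow B - {{}})))
        (geometric_realization (Pow B - {{}}) - {barycenter B}) \<cong> integer_group) \<and>
    (p \<noteq> int (card B) - 1 \<longrightarrow>
      trivial_group (relative_homology_group p (top_of_set (geometric_realization (Pow B - {{}})))
        (geometric_realization (Pow B - {{}}) - {barycenter B})))"
  using finite[of B] assms
proof (induction B arbitrary: p rule: finite_ne_induct)
  case (singleton a)
  have "Pow {a} - {{}} = {{a}}" by auto
  \<comment> \<open>Puncturing a single point leaves the empty set, so this case is the homology of
    a point.\<close>
  then have D: "geometric_realization (Pow {a} - {{}}) = {barycenter {a}}"
    using barycenter_in_geometric_realization[of "{a}"] by (simp add: geometric_realization_def)
  show ?case
    unfolding D using homology_coefficients[of "top_of_set {barycenter {a}}"]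
      homology_dimension_axiom[of "top_of_set {barycenter {a}}" "barycenter {a}" p] by auto
next
  case (insert a F)
  define B where "B = insert a F"
  let ?D = "geometric_realization (Pow B - {{}})"
  let ?E = "geometric_realization (Pow B - {{}} - {B})"
  let ?R = "\<lambda>p F. relative_homology_group p (top_of_set (geometric_realization (Pow F - {{}})))
        (geometric_realization (Pow F - {{}}) - {barycenter F})"
  have Bne: "B \<noteq> {}" and FB: "F \<subset> B" using insert unfolding B_def by auto
  note SB = abstract_simplicial_complex_Pow[of B]
  have SE: "abstract_simplicial_complex (Pow B - {{}} - {B})"
    by (rule abstract_simplicial_complex_remove_maximal[OF SB]) auto
  have SF: "abstract_simplicial_complex (Pow B - {{}} - {B} - {F})"
    by (rule abstract_simplicial_complex_remove_maximal[OF SE]) (use insert in \<open>auto simp: B_def\<close>)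
  have BP: "B \<in> Pow B - {{}}" using Bne by auto
  have FP: "F \<in> Pow B - {{}} - {B}" using FB insert by auto
  \<comment> \<open>As the full simplex is contractible, its homology relative to the punctured
    simplex is the reduced homology of the latter, one degree lower.\<close>
  have "contractible ?D"
    by (rule contractible_geometric_realization_cone[OF SB, of a]) (auto simp: B_def)
  moreover have E: "(?D - {barycenter B}) homotopy_eqv ?E"
    by (rule geometric_realization_puncture[OF SB BP]) auto
  \<comment> \<open>The degree shift needs a nonempty punctured simplex. The vertex \<open>a\<close>
    lies on the boundary because \<open>F\<close> is nonempty.\<close>
  have "axis a 1 \<in> ?E"
    by (rule geometric_realizationI[OF SE, of "{a}"]) (use insert in \<open>auto simp: axis_def B_def\<close>)
  then have ne: "?D - {barycenter B} \<noteq> {}"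
    using E by (metis empty_iff homotopy_eqv_empty2)
  ultimately have "?R p B \<cong> reduced_homology_group (p - 1) (top_of_set (?D - {barycenter B}))"
    using isomorphic_group_relative_homology_of_contractible[of "top_of_set ?D" "?D - {barycenter B}" p]
    by (simp add: subtopology_subtopology Int_absorb1)
  also have "\<dots> \<cong> reduced_homology_group (p - 1) (top_of_set ?E)"
    by (rule homotopy_equivalent_space_imp_isomorphic_reduced_homology_groups[OF E])
  also have "\<dots> \<cong> relative_homology_group (p - 1) (top_of_set ?E) (?E - {barycenter F})"
  proof -
    have "contractible (geometric_realization (Pow B - {{}} - {B} - {F}))"
    proof (rule contractible_geometric_realization_cone[OF SF, of a])
      show "{a} \<in> Pow B - {{}} - {B} - {F}" using insert by (auto simp: B_def)
      show "insert a s \<in> Pow B - {{}} - {B} - {F}" if "s \<in> Pow B - {{}} - {B} - {F}" for s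
      proof -
        \<comment> \<open>If \<open>a\<close> is in \<open>s\<close>, then \<open>insert a s\<close>
          is \<open>s\<close>, which is not \<open>B\<close>; otherwise equality would give
          \<open>s = F\<close>, which has been removed.\<close>
        have "insert a s \<noteq> insert a F"
          using that insert.hyps unfolding B_def by (metis Diff_iff insert_absorb insert_ident singletonI)
        then show ?thesis using that insert.hyps unfolding B_def by auto
      qed
    qed
    moreover have EF: "(?E - {barycenter F}) homotopy_eqv geometric_realization (Pow B - {{}} - {B} - {F})"
      by (rule geometric_realization_puncture[OF SE FP]) (use insert in \<open>auto simp: B_def\<close>)
    ultimately have "contractible (?E - {barycenter F})"
      using homotopy_eqv_contractibility by blast
    moreover have "axis a 1 \<in> ?E - {barycenter F}"
      using \<open>axis a 1 \<in> ?E\<close> insert by (auto simp: barycenter_def vec_eq_iff axis_def)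
    ultimately show ?thesis
      by (intro isomorphic_reduced_homology_by_contractible)
        (auto simp: subtopology_subtopology Int_absorb1)
  qed
  also have "\<dots> \<cong> ?R (p - 1) F"
    by (rule group.iso_sym[OF _ local_homology_maximal_simplex[OF SE FP]])
      (use insert in \<open>auto simp: B_def\<close>)
  finally have iso: "?R p B \<cong> ?R (p - 1) F" .
  have "card B = Suc (card F)" unfolding B_def using insert by simp
  then have p: "p = int (card B) - 1 \<longleftrightarrow> p - 1 = int (card F) - 1" by auto
  show ?case
    unfolding B_def[symmetric]
  proof (intro conjI impI)
    assume "p = int (card B) - 1"
    then have "?R (p - 1) F \<cong> integer_group" using insert.IH[of "p - 1"] p by blast
    then show "?R p B \<cong> integer_group" by (rule iso_trans[OF iso])
  next
    assume "p \<noteq> int (card B) - 1"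
    then have "trivial_group (?R (p - 1) F)" using insert.IH[of "p - 1"] p by blast
    then show "trivial_group (?R p B)" using isomorphic_group_triviality[OF iso] by simp
  qed
qed

lemma relative_homology_maximal_simplex:
  fixes S :: "'n::finite set set"
  assumes S: "abstract_simplicial_complex S" and B: "B \<in> S" and max: "\<forall>s\<in>S. B \<subseteq> s \<longrightarrow> s = B"
  defines "R \<equiv> \<lambda>p. relative_homology_group p (top_of_set (geometric_realization S))
        (geometric_realization S - {barycenter B})"
  shows "R (int (card B) - 1) \<cong> integer_group"
    and "p \<noteq> int (card B) - 1 \<Longrightarrow> trivial_group (R p)"
    and "noetherian_group (R p)"
proof -
  have Bne: "B \<noteq> {}" using abstract_simplicial_complexD[OF S B] by blast
  have iso: "R p \<cong> relative_homology_group p (top_of_set (geometric_realization (Pow B - {{}})))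
           (geometric_realization (Pow B - {{}}) - {barycenter B})" for p
    unfolding R_def by (rule group.iso_sym[OF _ local_homology_maximal_simplex[OF S B max]]) auto
  show Z: "R (int (card B) - 1) \<cong> integer_group"
    using iso_trans[OF iso] relative_homology_punctured_simplex[OF Bne] by blast
  show T: "trivial_group (R p)" if "p \<noteq> int (card B) - 1" for p
    using isomorphic_group_triviality[OF iso] relative_homology_punctured_simplex[OF Bne, of p] that
    by (simp add: R_def)
  show "noetherian_group (R p)"
  proof (cases "p = int (card B) - 1")
    case True
    have "integer_group \<cong> R p"
      using Z True by (simp add: R_def group.iso_sym)
    then show ?thesis
      by (rule noetherian_group_isomorphic) (auto simp: R_def noetherian_group_integer)
  qed (use T noetherian_group_trivial in blast)
qed

text \<open>Maximal simplices are removed one at a time. The sequence of the pair puts the homology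
  of the realization between that of the punctured space, known by induction, and the local
  homology, which is infinite cyclic or trivial.\<close>

lemma noetherian_homology_geometric_realization:
  fixes S :: "'n::finite set set"
  assumes "abstract_simplicial_complex S"
  shows "noetherian_group (homology_group p (top_of_set (geometric_realization S)))"
  using finite[of S] assms
proof (induction S rule: finite_psubset_induct)
  case (psubset S)
  show ?case
  proof (cases "S = {}")
    case True
    then show ?thesis
      by (intro noetherian_group_trivial trivial_homology_group_empty) (simp add: geometric_realization_def)
  next
    case False
    then obtain B where B: "B \<in> S" "\<forall>s\<in>S. B \<subseteq> s \<longrightarrow> s = B"
      using finite_has_maximal[OF psubset.hyps] by auto
    let ?X = "geometric_realization S"
    have S': "abstract_simplicial_complex (S - {B})"
      by (rule abstract_simplicial_complex_remove_maximal[OF psubset.prems B(2)])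
    have "homology_group p (top_of_set (geometric_realization (S - {B}))) \<cong>
        homology_group p (top_of_set (?X - {barycenter B}))"
      by (rule homotopy_equivalent_space_imp_isomorphic_homology_groups[OF
          homotopy_equivalent_space_sym[THEN iffD1, OF geometric_realization_puncture[OF psubset.prems B]]])
    then have n1: "noetherian_group (homology_group p (top_of_set (?X - {barycenter B})))"
      by (rule noetherian_group_isomorphic) (use psubset.IH[OF _ S'] B in auto)
    have "subtopology (top_of_set ?X) (?X - {barycenter B}) = top_of_set (?X - {barycenter B})"
      by (simp add: subtopology_subtopology Int_absorb1)
    then have "exact_seq ([relative_homology_group p (top_of_set ?X) (?X - {barycenter B}),
        homology_group p (top_of_set ?X), homology_group p (top_of_set (?X - {barycenter B}))],
        [hom_induced p (top_of_set ?X) {} (top_of_set ?X) (?X - {barycenter B}) id,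
         hom_induced p (top_of_set (?X - {barycenter B})) {} (top_of_set ?X) {} id])"
      using homology_exactness_axiom_3[of p "top_of_set ?X" "?X - {barycenter B}"] by simp
    then show ?thesis
      by (rule noetherian_group_exact_seq[OF _ n1 relative_homology_maximal_simplex(3)[OF psubset.prems B]])
  qed
qed

text \<open>A homotopy equivalence only yields abstract isomorphisms between the homology of
  \<open>?A\<close> and \<open>?X\<close>, possibly not induced by the inclusion; the hopfian
  argument handles exactly this. Local homology vanishes in degrees \<open>?d + 1\<close> and
  \<open>?d - 1\<close>, so the inclusion is injective on homology in degree \<open>?d\<close> and
  surjective in degree \<open>?d - 1\<close>. Degrees are integers, which covers a single vertex
  with \<open>?d = 0\<close>.\<close>

lemma geometric_realization_remove_maximal_not_homotopy_eqv:
  fixes S :: "'n::finite set set"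
  assumes S: "abstract_simplicial_complex S" and B: "B \<in> S" and max: "\<forall>s\<in>S. B \<subseteq> s \<longrightarrow> s = B"
  shows "\<not> geometric_realization S homotopy_eqv geometric_realization (S - {B})"
proof
  assume eqv: "geometric_realization S homotopy_eqv geometric_realization (S - {B})"
  let ?X = "geometric_realization S"
  let ?A = "?X - {barycenter B}"
  let ?d = "int (card B) - 1"
  have sub: "subtopology (top_of_set ?X) ?A = top_of_set ?A"
    by (simp add: subtopology_subtopology Int_absorb1)
  have "?A homotopy_eqv ?X"
    using geometric_realization_puncture[OF S B max] eqv
    by (rule homotopy_eqv_trans[OF _ homotopy_equivalent_space_sym[THEN iffD1]])
  then have AX: "homology_group p (top_of_set ?A) \<cong> homology_group p (top_of_set ?X)" for p
    by (rule homotopy_equivalent_space_imp_isomorphic_homology_groups)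
  have XA: "homology_group p (top_of_set ?X) \<cong> homology_group p (top_of_set ?A)" for p
    by (rule group.iso_sym[OF _ AX]) simp
  note nX = noetherian_homology_geometric_realization[OF S]
  have nA: "noetherian_group (homology_group p (top_of_set ?A))" for p
    by (rule noetherian_group_isomorphic[OF XA]) (auto simp: nX)
  note R = relative_homology_maximal_simplex[OF S B max]
  let ?i = "\<lambda>p. hom_induced p (top_of_set ?A) {} (top_of_set ?X) {} id"
  let ?q = "\<lambda>p. hom_induced p (top_of_set ?X) {} (top_of_set ?X) ?A id"
  let ?b = "\<lambda>p. hom_boundary p (top_of_set ?X) ?A"
  let ?H = "\<lambda>p Y. homology_group p (top_of_set Y)"
  let ?R = "\<lambda>p. relative_homology_group p (top_of_set ?X) ?A"
  have e1: "exact_seq ([?H (p - 1) ?A, ?R p, ?H p ?X], [?b p, ?q p])" for p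
    using homology_exactness_axiom_1[of p "top_of_set ?X" ?A] by (simp only: sub)
  have e2: "exact_seq ([?H (p - 1) ?X, ?H (p - 1) ?A, ?R p], [?i (p - 1), ?b p])" for p
    using homology_exactness_axiom_2[of p "top_of_set ?X" ?A] by (simp only: sub)
  have e3: "exact_seq ([?R p, ?H p ?X, ?H p ?A], [?q p, ?i p])" for p
    using homology_exactness_axiom_3[of p "top_of_set ?X" ?A] by (simp only: sub)
  show False
  proof (rule exact_seq_integer_group_not_isomorphic)
    show "exact_seq ([?H (?d - 1) ?X, ?H (?d - 1) ?A, ?R ?d, ?H ?d ?X, ?H ?d ?A],
       [?i (?d - 1), ?b ?d, ?q ?d, ?i ?d])"
      using e1[of ?d] e2[of ?d] e3[of ?d] by simp
    show "inj_on (?i ?d) (carrier (?H ?d ?A))"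
    proof -
      interpret i: group_hom "?H ?d ?A" "?H ?d ?X" "?i ?d"
        using e2[of "?d + 1"] by (auto simp: group_hom_def group_hom_axioms_def)
      interpret b: group_hom "?R (?d + 1)" "?H ?d ?A" "?b (?d + 1)"
        using e2[of "?d + 1"] by (auto simp: group_hom_def group_hom_axioms_def)
      have "trivial_group (?R (?d + 1))" by (rule R(2)) simp
      then have "?b (?d + 1) ` carrier (?R (?d + 1)) = {\<one>\<^bsub>?H ?d ?A\<^esub>}"
        by (rule b.image_from_trivial_group)
      then have "kernel (?H ?d ?A) (?H ?d ?X) (?i ?d) = {\<one>\<^bsub>?H ?d ?A\<^esub>}"
        using e2[of "?d + 1"] by simp
      then show ?thesis by (rule i.trivial_ker_imp_inj)
    qed
    show "?i (?d - 1) ` carrier (?H (?d - 1) ?A) = carrier (?H (?d - 1) ?X)"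
    proof -
      have "trivial_group (?R (?d - 1))" by (rule R(2)) simp
      then have "kernel (?H (?d - 1) ?X) (?R (?d - 1)) (?q (?d - 1)) = carrier (?H (?d - 1) ?X)"
        using e3[of "?d - 1"] by (intro group_hom.kernel_to_trivial_group) (auto simp: group_hom_def group_hom_axioms_def)
      then show ?thesis using e3[of "?d - 1"] by simp
    qed
  qed (use R(1) nX nA AX in auto)
qed

section \<open>Past links in cubical complexes\<close>

text \<open>Binary vectors are encoded as coordinate sets, so that past links become families of
  sets and cube inclusions become set inclusions.\<close>

definition indicator_vec :: "'n set \<Rightarrow> real ^ 'n::finite" where
  "indicator_vec s = (\<chi> i. if i \<in> s then 1 else 0)"

lemma indicator_vec_nth: "indicator_vec s $ i = (if i \<in> s then 1 else 0)"
  by (simp add: indicator_vec_def)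

lemma indicator_vec_support: "{i. indicator_vec s $ i = 1} = s"
  by (simp add: indicator_vec_nth)

lemma indicator_vec_nonneg [simp]: "0 \<le> indicator_vec s"
  by (simp add: less_eq_vec_def indicator_vec_nth)

lemma indicator_vec_le_iff: "indicator_vec s \<le> indicator_vec t \<longleftrightarrow> s \<subseteq> t"
  by (auto simp: less_eq_vec_def indicator_vec_nth subset_iff)

lemma indicator_vec_eq_0_iff: "indicator_vec s = 0 \<longleftrightarrow> s = {}"
  by (auto simp: vec_eq_iff indicator_vec_nth)

lemma binary_vectors_eq: "binary_vectors = range indicator_vec"
proof
  show "binary_vectors \<subseteq> range (indicator_vec :: 'a set \<Rightarrow> _)"
  proof
    fix j :: "real ^ 'a" assume "j \<in> binary_vectors"
    then have "j = indicator_vec {i. j $ i = 1}"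
      by (auto simp: binary_vectors_def vec_eq_iff indicator_vec_nth)
    then show "j \<in> range indicator_vec" by blast
  qed
qed (auto simp: binary_vectors_def indicator_vec_nth)

lemma elementary_cube_iff:
  "elementary_cube c \<longleftrightarrow> (\<exists>v\<in>integer_vectors. \<exists>s. c = {v - indicator_vec s..v})"
  unfolding elementary_cube_def binary_vectors_eq by blast

lemma strata_iff:
  "\<gamma> \<in> strata K \<longleftrightarrow> (\<exists>v\<in>integer_vectors. \<exists>s. \<gamma> = rel_interior {v - indicator_vec s..v} \<and>
     closure \<gamma> = {v - indicator_vec s..v} \<and> {v - indicator_vec s..v} \<subseteq> K)" (is "_ \<longleftrightarrow> ?R")
proof
  assume "\<gamma> \<in> strata K"
  then obtain c where c: "elementary_cube c" "c \<subseteq> K" "\<gamma> = rel_interior c"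
    unfolding strata_def by blast
  then show ?R
    using closure_rel_interior_elementary_cube[OF c(1)] unfolding elementary_cube_iff by blast
next
  assume ?R
  then show "\<gamma> \<in> strata K"
    unfolding strata_def elementary_cube_iff by blast
qed

lemma past_link_complex_eq:
  "past_link_complex K v = {s. s \<noteq> {} \<and> {v - indicator_vec s..v} \<subseteq> K}"
proof -
  have "past_link K v = indicator_vec ` {s. s \<noteq> {} \<and> {v - indicator_vec s..v} \<subseteq> K}"
    unfolding past_link_def binary_vectors_eq by (auto simp: indicator_vec_eq_0_iff)
  then show ?thesis
    unfolding past_link_complex_def by (simp add: image_image indicator_vec_support)
qed

lemma abstract_simplicial_complex_past_link: "abstract_simplicial_complex (past_link_complex K v)"
  unfolding abstract_simplicial_complex_def
proof (intro ballI conjI allI impI)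
  fix s t assume s: "s \<in> past_link_complex K v" and t: "t \<noteq> {} \<and> t \<subseteq> s"
  have "{v - indicator_vec t..v} \<subseteq> {v - indicator_vec s..v}"
    using t by (simp add: atLeastatMost_subset_iff indicator_vec_le_iff)
  then show "t \<in> past_link_complex K v"
    using s t unfolding past_link_complex_eq by blast
qed (simp add: past_link_complex_eq)

text \<open>From a relative interior point, the segments coming from the corners \<open>a\<close>
  and \<open>b\<close> can be prolonged a little inside the box. If a coordinate of \<open>x\<close>
  meets one end of its interval, this forces the interval to be degenerate.\<close>

lemma rel_interior_box_nth:
  fixes a b x :: "real ^ 'n"
  assumes x: "x \<in> rel_interior {a..b}" and ab: "a \<le> b"
  shows "(a $ i = x $ i \<and> x $ i = b $ i) \<or> (a $ i < x $ i \<and> x $ i < b $ i)"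
proof -
  have "convex {a..b}" by (simp add: interval_cbox)
  moreover have "{a..b} \<noteq> {}" using ab by simp
  ultimately have "\<forall>y\<in>{a..b}. \<exists>e>1. (1 - e) *\<^sub>R y + e *\<^sub>R x \<in> {a..b}"
    using convex_rel_interior_iff x by blast
  note iff = this
  obtain e where e: "e > 1" "(1 - e) *\<^sub>R a + e *\<^sub>R x \<in> {a..b}"
    using iff ab by (meson atLeastAtMost_iff order_refl)
  obtain d where d: "d > 1" "(1 - d) *\<^sub>R b + d *\<^sub>R x \<in> {a..b}"
    using iff ab by (meson atLeastAtMost_iff order_refl)
  have xab: "a $ i \<le> x $ i" "x $ i \<le> b $ i"
    using rel_interior_subset x by (force simp: less_eq_vec_def)+
  have "(1 - e) * a $ i + e * x $ i \<le> b $ i" "a $ i \<le> (1 - d) * b $ i + d * x $ i"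
    using e(2) d(2) by (auto simp: less_eq_vec_def)
  then have 1: "(e - 1) * (x $ i - a $ i) \<le> b $ i - x $ i" "(d - 1) * (b $ i - x $ i) \<le> x $ i - a $ i"
    by (auto simp: algebra_simps)
  have "x $ i = a $ i" if "x $ i = b $ i"
    using 1(1) that e(1) xab by (auto simp: mult_le_0_iff)
  moreover have "x $ i = b $ i" if "x $ i = a $ i"
    using 1(2) that d(1) xab by (auto simp: mult_le_0_iff)
  ultimately have "x $ i = a $ i \<longleftrightarrow> x $ i = b $ i" by metis
  then show ?thesis using xab by (auto simp: order.strict_iff_order)
qed

section \<open>Integer boxes, maximal cofaces and the effect of a collapse\<close>

lemma Ints_less_imp_add1_le:
  fixes a b :: real
  assumes "a \<in> \<int>" "b \<in> \<int>" "a < b"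
  shows "a + 1 \<le> b"
  using assms by (auto elim!: Ints_cases)

lemma integer_vectorsD: "v \<in> integer_vectors \<Longrightarrow> v $ i \<in> \<int>"
  by (simp add: integer_vectors_def)

lemma integer_vectors_diff_indicator:
  "v \<in> integer_vectors \<Longrightarrow> v - indicator_vec s \<in> integer_vectors"
  by (simp add: integer_vectors_def indicator_vec_nth)

text \<open>In a nondegenerate direction of the second cube, \<open>x\<close> lies strictly between
  consecutive integers, so an interval with integer ends around \<open>x\<close> contains the whole
  unit interval. In a degenerate direction \<open>x\<close> itself gives the bound.\<close>

lemma elementary_cube_subset_of_meets_rel_interior:
  assumes v: "v \<in> integer_vectors" and w: "w \<in> integer_vectors"
    and x: "x \<in> {v - indicator_vec s..v}" "x \<in> rel_interior {w - indicator_vec t..w}"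
  shows "{w - indicator_vec t..w} \<subseteq> {v - indicator_vec s..v}"
proof -
  have "w - indicator_vec t \<le> w" using indicator_vec_nonneg by simp
  note r = rel_interior_box_nth[OF x(2) this]
  have "(v - indicator_vec s) $ i \<le> (w - indicator_vec t) $ i \<and> w $ i \<le> v $ i" for i
  proof (cases "(w - indicator_vec t) $ i = x $ i \<and> x $ i = w $ i")
    case True
    then show ?thesis using x(1) by (simp add: less_eq_vec_def) (metis True)
  next
    case False
    then have b: "(w - indicator_vec t) $ i < x $ i" "x $ i < w $ i" using r[of i] by blast+
    have "(v - indicator_vec s) $ i \<le> x $ i" "x $ i \<le> v $ i"
      using x(1) by (auto simp: less_eq_vec_def)
    then have "(v - indicator_vec s) $ i < w $ i" "(w - indicator_vec t) $ i < v $ i"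
      using b by linarith+
    then have "(v - indicator_vec s) $ i + 1 \<le> w $ i" "(w - indicator_vec t) $ i + 1 \<le> v $ i"
      using v w by (auto intro!: Ints_less_imp_add1_le integer_vectorsD integer_vectors_diff_indicator
          simp del: vector_minus_component)
    moreover have "w $ i \<le> (w - indicator_vec t) $ i + 1" by (simp add: indicator_vec_nth)
    ultimately show ?thesis by linarith
  qed
  then show ?thesis
    unfolding atLeastatMost_subset_iff less_eq_vec_def by blast
qed

text \<open>A coface in \<open>K\<close> of greatest dimension is maximal: a further coface has a
  larger or equal direction set, hence the same one, and then the same corners.\<close>

lemma maximal_cube_above:
  assumes v: "v \<in> integer_vectors" and K: "{v - indicator_vec s..v} \<subseteq> K"
  shows "\<exists>\<rho>. maximal_cube K \<rho> \<and> {v - indicator_vec s..v} \<subseteq> closure \<rho>"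
proof -
  define P where "P = (\<lambda>(w :: real ^ 'a, t). w \<in> integer_vectors \<and>
    {v - indicator_vec s..v} \<subseteq> {w - indicator_vec t..w} \<and> {w - indicator_vec t..w} \<subseteq> K)"
  have "P (v, s)" using v K by (simp add: P_def)
  moreover have "\<forall>y. P y \<longrightarrow> card (snd y) < Suc CARD('a)"
    by (simp add: card_mono less_Suc_eq_le)
  ultimately have "\<exists>x. P x \<and> (\<forall>y. P y \<longrightarrow> card (snd y) \<le> card (snd x))"
    by (rule ex_has_greatest_nat)
  then obtain w t where wt: "P (w, t)" and greatest: "\<And>w' t'. P (w', t') \<Longrightarrow> card t' \<le> card t"
    by (metis prod.exhaust snd_conv)
  let ?c = "{w - indicator_vec t..w}"
  have w: "w \<in> integer_vectors" "{v - indicator_vec s..v} \<subseteq> ?c" "?c \<subseteq> K"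
    using wt by (auto simp: P_def)
  have cl: "closure (rel_interior ?c) = ?c"
    using w(1) by (intro closure_rel_interior_elementary_cube) (auto simp: elementary_cube_iff)
  have "maximal_cube K (rel_interior ?c)"
    unfolding maximal_cube_def
  proof (intro conjI ballI impI)
    show "rel_interior ?c \<in> strata K"
      unfolding strata_iff using w cl by blast
    fix \<rho> assume "\<rho> \<in> strata K" and f: "face (rel_interior ?c) \<rho>"
    then obtain u r where u: "u \<in> integer_vectors" "\<rho> = rel_interior {u - indicator_vec r..u}"
      "closure \<rho> = {u - indicator_vec r..u}" "{u - indicator_vec r..u} \<subseteq> K"
      unfolding strata_iff by blast
    have sub: "?c \<subseteq> {u - indicator_vec r..u}" using f u(3) cl by (simp add: face_def)
    then have le: "u - indicator_vec r \<le> w - indicator_vec t" "w \<le> u"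
      using indicator_vec_nonneg[of t] by (auto simp: atLeastatMost_subset_iff)
    have "indicator_vec t \<le> indicator_vec r"
      using add_mono[OF le] by (simp add: algebra_simps)
    then have "t \<subseteq> r" by (simp add: indicator_vec_le_iff)
    moreover have "P (u, r)" using u w sub by (auto simp: P_def)
    then have "card r \<le> card t" by (rule greatest)
    ultimately have "r = t" using card_seteq[of r t] by simp
    then have "u = w" using le by simp
    then show "\<rho> = rel_interior ?c" using u(2) \<open>r = t\<close> by simp
  qed
  then show ?thesis using w(2) cl by metis
qed

text \<open>Freeness speaks of maximal cubes only; passing to a maximal cube above extends it to all
  cofaces of \<open>\<tau>\<close>.\<close>

lemma free_face_coface_subset:
  assumes "free_face K \<tau> \<sigma>" "v \<in> integer_vectors" "{v - indicator_vec s..v} \<subseteq> K"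
    "closure \<tau> \<subseteq> {v - indicator_vec s..v}"
  shows "{v - indicator_vec s..v} \<subseteq> closure \<sigma>"
proof -
  obtain \<rho> where "maximal_cube K \<rho>" "{v - indicator_vec s..v} \<subseteq> closure \<rho>"
    using maximal_cube_above[OF assms(2,3)] by blast
  moreover from this have "\<rho> = \<sigma>" using assms(1,4) unfolding free_face_def face_def by blast
  ultimately show ?thesis by simp
qed

text \<open>A cube containing \<open>\<tau>\<close> lies in \<open>\<sigma>\<close> by freeness, so
  its own relative interior is removed. Conversely, if a removed stratum meets a cube, its closure
  lies in that cube and brings \<open>\<tau>\<close> along.\<close>

lemma past_link_complex_collapse:
  assumes free: "free_face K \<tau> \<sigma>" and v: "v \<in> integer_vectors"
  shows "past_link_complex (collapse K \<tau> \<sigma>) v =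
    {s \<in> past_link_complex K v. \<not> closure \<tau> \<subseteq> {v - indicator_vec s..v}}"
proof -
  have "{v - indicator_vec s..v} \<subseteq> collapse K \<tau> \<sigma> \<longleftrightarrow> \<not> closure \<tau> \<subseteq> {v - indicator_vec s..v}"
    if c: "{v - indicator_vec s..v} \<subseteq> K" for s
  proof
    let ?c = "{v - indicator_vec s..v}"
    assume *: "?c \<subseteq> collapse K \<tau> \<sigma>"
    show "\<not> closure \<tau> \<subseteq> ?c"
    proof
      assume t: "closure \<tau> \<subseteq> ?c"
      have cl: "closure (rel_interior ?c) = ?c"
        using v by (intro closure_rel_interior_elementary_cube) (auto simp: elementary_cube_iff)
      have "?c \<subseteq> closure \<sigma>" by (rule free_face_coface_subset[OF free v c t])
      moreover have "rel_interior ?c \<in> strata K"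
        unfolding strata_iff using v c cl by blast
      ultimately have "rel_interior ?c \<inter> collapse K \<tau> \<sigma> = {}"
        unfolding collapse_def face_def using t cl by blast
      moreover have "rel_interior ?c \<noteq> {}"
        using cl indicator_vec_nonneg[of s] by (metis atLeastAtMost_iff closure_empty diff_ge_0_iff_ge
            diff_diff_eq2 diff_self empty_iff add_0 add_diff_cancel_left' order_refl)
      ultimately show False using * rel_interior_subset[of ?c] by blast
    qed
  next
    let ?c = "{v - indicator_vec s..v}"
    assume t: "\<not> closure \<tau> \<subseteq> ?c"
    show "?c \<subseteq> collapse K \<tau> \<sigma>"
    proof
      fix x assume x: "x \<in> ?c"
      have False if "\<gamma> \<in> strata K" "face \<tau> \<gamma>" "x \<in> \<gamma>" for \<gamma>
      proof -
        obtain w r where w: "w \<in> integer_vectors" "\<gamma> = rel_interior {w - indicator_vec r..w}"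
          "closure \<gamma> = {w - indicator_vec r..w}"
          using \<open>\<gamma> \<in> strata K\<close> unfolding strata_iff by blast
        have "{w - indicator_vec r..w} \<subseteq> ?c"
          using elementary_cube_subset_of_meets_rel_interior[OF v w(1) x] that(3) w(2) by blast
        then show False using t that(2) w(3) unfolding face_def by blast
      qed
      then show "x \<in> collapse K \<tau> \<sigma>" using x c unfolding collapse_def by blast
    qed
  qed
  moreover have "collapse K \<tau> \<sigma> \<subseteq> K" unfolding collapse_def by blast
  ultimately show ?thesis unfolding past_link_complex_eq by blast
qed

theorem theorem4:
  fixes K \<tau> \<sigma> :: "(real ^ 'n) set"
  assumes "cubical_complex K"
    and "\<tau> \<in> strata K" and "\<sigma> \<in> strata K"
    and "free_face K \<tau> \<sigma>"
  shows "lpdc_pair K \<tau> \<sigma> \<longleftrightarrow> min_vertex \<sigma> \<notin> cube_verts \<tau>"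
proof -
  note free = assms(4)
  obtain q T where q: "q \<in> integer_vectors" and \<tau>: "\<tau> = rel_interior {q - indicator_vec T..q}"
    and cl\<tau>: "closure \<tau> = {q - indicator_vec T..q}"
    using assms(2) unfolding strata_iff by blast
  obtain M B\<^sub>0 where M: "M \<in> integer_vectors" and \<sigma>: "\<sigma> = rel_interior {M - indicator_vec B\<^sub>0..M}"
    and cl\<sigma>: "closure \<sigma> = {M - indicator_vec B\<^sub>0..M}" and \<sigma>K: "{M - indicator_vec B\<^sub>0..M} \<subseteq> K"
    using assms(3) unfolding strata_iff by blast
  define p where "p = q - indicator_vec T"
  define m where "m = M - indicator_vec B\<^sub>0"
  have pq: "p \<le> q" and mM: "m \<le> M"
    using indicator_vec_nonneg by (auto simp: p_def m_def)
  have m: "m \<in> integer_vectors" and p: "p \<in> integer_vectors"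
    unfolding m_def p_def using M q by (auto intro: integer_vectors_diff_indicator)
  have "{p..q} \<subseteq> {m..M}"
    using free cl\<tau> cl\<sigma> unfolding free_face_def face_def p_def m_def by simp
  then have mp: "m \<le> p" and qM: "q \<le> M" using pq by (auto simp: atLeastatMost_subset_iff)
  have "min_vertex \<sigma> = m"
    unfolding \<sigma> m_def using M by (intro min_vertex_cube) (auto simp: binary_vectors_eq)
  then have min_iff: "min_vertex \<sigma> \<in> cube_verts \<tau> \<longleftrightarrow> m = p"
    using m mp pq cl\<tau> by (auto simp: cube_verts_def p_def)
  have link: "past_link_complex (collapse K \<tau> \<sigma>) v =
      {s \<in> past_link_complex K v. \<not> {p..q} \<subseteq> {v - indicator_vec s..v}}" if "v \<in> integer_vectors" for v
    using past_link_complex_collapse[OF free that] cl\<tau> by (simp add: p_def)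
  have coface: "{v - indicator_vec s..v} \<subseteq> {m..M}"
    if "v \<in> integer_vectors" "s \<in> past_link_complex K v" "{p..q} \<subseteq> {v - indicator_vec s..v}" for v s
    using free_face_coface_subset[OF free that(1)] that(2,3) cl\<tau> cl\<sigma>
    by (simp add: past_link_complex_eq p_def m_def del: atLeastatMost_subset_iff)
  show ?thesis
  proof
    assume lpdc: "lpdc_pair K \<tau> \<sigma>"
    show "min_vertex \<sigma> \<notin> cube_verts \<tau>"
    proof
      assume "min_vertex \<sigma> \<in> cube_verts \<tau>"
      then have pm: "p = m" using min_iff by simp
      have B\<^sub>0: "B\<^sub>0 \<noteq> {}"
      proof
        assume "B\<^sub>0 = {}"
        then have "m = M" using indicator_vec_eq_0_iff[of B\<^sub>0] by (simp add: m_def)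
        then have "{p..q} = {m..M}" using pm pq qM by auto
        then have "\<tau> = \<sigma>" unfolding \<tau> \<sigma> p_def m_def by (rule arg_cong)
        then show False using free unfolding free_face_def by blast
      qed
      \<comment> \<open>A removed stratum through \<open>M\<close> would have minimum
        \<open>m\<close>, squeezed between \<open>p = m\<close> and \<open>m\<close>, and maximum at
        most \<open>M\<close>. A relative interior point at the maximum forces every direction to be
        degenerate, so \<open>m = M\<close>, against \<open>B\<^sub>0\<close> being
        nonempty.\<close>
      have "M \<in> collapse K \<tau> \<sigma>"
      proof -
        have False if \<gamma>: "\<gamma> \<in> strata K" "face \<tau> \<gamma>" "face \<gamma> \<sigma>" "M \<in> \<gamma>" for \<gamma>
        proof -
          obtain w r where w: "w \<in> integer_vectors" "\<gamma> = rel_interior {w - indicator_vec r..w}"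
            "closure \<gamma> = {w - indicator_vec r..w}"
            using \<gamma>(1) unfolding strata_iff by blast
          have le: "w - indicator_vec r \<le> w" using indicator_vec_nonneg by simp
          have "{p..q} \<subseteq> {w - indicator_vec r..w}" "{w - indicator_vec r..w} \<subseteq> {m..M}"
            using \<gamma>(2,3) w(3) cl\<tau> cl\<sigma> unfolding face_def p_def m_def by simp_all
          then have "w - indicator_vec r \<le> p" "m \<le> w - indicator_vec r" "w \<le> M"
            using pq le by (simp_all add: atLeastatMost_subset_iff)
          then have "w - indicator_vec r = m" "w \<le> M"
            using pm by auto
          then have "m $ i = M $ i" for i
            using rel_interior_box_nth[of M "w - indicator_vec r" w i] le \<gamma>(4) w(2)
            by (auto simp: less_eq_vec_def dest: spec[of _ i])
          then have "indicator_vec B\<^sub>0 = 0" by (simp add: m_def vec_eq_iff)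
          then show False using B\<^sub>0 by (simp add: indicator_vec_eq_0_iff)
        qed
        then show ?thesis using \<sigma>K mM unfolding collapse_def m_def by auto
      qed
      then have "geometric_realization (past_link_complex K M) homotopy_eqv
          geometric_realization (past_link_complex (collapse K \<tau> \<sigma>) M)"
        using lpdc M unfolding lpdc_pair_def complex_verts_def by blast
      moreover have B\<^sub>0L: "B\<^sub>0 \<in> past_link_complex K M"
        using B\<^sub>0 \<sigma>K by (simp add: past_link_complex_eq)
      have iff: "{p..q} \<subseteq> {M - indicator_vec s..M} \<longleftrightarrow> B\<^sub>0 \<subseteq> s" for s
        using pq qM pm by (auto simp: atLeastatMost_subset_iff m_def indicator_vec_le_iff)
      have max: "\<forall>s\<in>past_link_complex K M. B\<^sub>0 \<subseteq> s \<longrightarrow> s = B\<^sub>0"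
      proof (intro ballI impI)
        fix s assume s: "s \<in> past_link_complex K M" "B\<^sub>0 \<subseteq> s"
        then have "{M - indicator_vec s..M} \<subseteq> {m..M}" using coface[OF M s(1)] iff by blast
        then have "s \<subseteq> B\<^sub>0"
          using indicator_vec_nonneg[of s] by (simp add: atLeastatMost_subset_iff m_def indicator_vec_le_iff)
        then show "s = B\<^sub>0" using s by simp
      qed
      have "past_link_complex (collapse K \<tau> \<sigma>) M = past_link_complex K M - {B\<^sub>0}"
        unfolding link[OF M] iff using max by auto
      ultimately show False
        using geometric_realization_remove_maximal_not_homotopy_eqv[OF abstract_simplicial_complex_past_link B\<^sub>0L max]
        by simp
    qed
  next
    assume "min_vertex \<sigma> \<notin> cube_verts \<tau>"
    then have "m \<noteq> p" using min_iff by simp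
    have "geometric_realization (past_link_complex K v) homotopy_eqv
        geometric_realization (past_link_complex (collapse K \<tau> \<sigma>) v)"
      if v: "v \<in> complex_verts (collapse K \<tau> \<sigma>)" for v
    proof -
      have vi: "v \<in> integer_vectors" and vK': "v \<in> collapse K \<tau> \<sigma>"
        using v unfolding complex_verts_def by auto
      show ?thesis
      proof (cases "\<exists>s\<in>past_link_complex K v. {p..q} \<subseteq> {v - indicator_vec s..v}")
        case False
        then have "past_link_complex (collapse K \<tau> \<sigma>) v = past_link_complex K v"
          unfolding link[OF vi] by blast
        then show ?thesis by (simp add: homotopy_equivalent_space_refl)
      next
        case True
        then obtain s\<^sub>0 where s\<^sub>0: "s\<^sub>0 \<in> past_link_complex K v" "{p..q} \<subseteq> {v - indicator_vec s\<^sub>0..v}" by blast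
        then have vp: "v - indicator_vec s\<^sub>0 \<le> p" and qv: "q \<le> v" using pq by (auto simp: atLeastatMost_subset_iff)
        have ms: "m \<le> v - indicator_vec s\<^sub>0" and vM: "v \<le> M"
          using coface[OF vi s\<^sub>0] indicator_vec_nonneg[of s\<^sub>0] by (auto simp: atLeastatMost_subset_iff)
        have mv: "m \<le> v" by (rule order_trans[OF ms]) simp
        \<comment> \<open>\<open>A\<close> is the least direction set whose cube below
          \<open>v\<close> contains \<open>\<tau>\<close>, and \<open>B\<close> the greatest whose
          cube lies in \<open>\<sigma>\<close>.\<close>
        define A where "A = {i. p $ i < v $ i}"
        define B where "B = {i. m $ i < v $ i}"
        have iff: "{p..q} \<subseteq> {v - indicator_vec s..v} \<longleftrightarrow> A \<subseteq> s" for s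
        proof -
          \<comment> \<open>The cube of \<open>s\<^sub>0\<close> reaches down to \<open>p\<close>,
            so \<open>p\<close> is at most one unit below \<open>v\<close> in each coordinate, and a
            unit step in the directions of \<open>A\<close> suffices.\<close>
          have "v $ i - 1 \<le> p $ i" for i
            using vp[unfolded less_eq_vec_def, rule_format, of i] by (simp add: indicator_vec_nth split: if_splits)
          then have "v - indicator_vec s \<le> p \<longleftrightarrow> A \<subseteq> s"
            unfolding less_eq_vec_def A_def subset_iff
            by (simp add: indicator_vec_nth) (meson linorder_not_le)
          then show ?thesis using pq qv by (simp add: atLeastatMost_subset_iff)
        qed
        have AB: "A \<subseteq> B"
          using mp unfolding A_def B_def less_eq_vec_def by (auto intro: le_less_trans)
        \<comment> \<open>If \<open>A\<close> were empty, \<open>\<tau>\<close> would be the vertex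
          \<open>v\<close> itself, which the collapse removes.\<close>
        have Ane: "A \<noteq> {}"
        proof
          assume "A = {}"
          then have "v \<le> p" unfolding A_def less_eq_vec_def by (auto simp: not_less)
          then have "q = v" "p = v" using pq qv by auto
          then have "v \<in> \<tau>" using \<tau> by (simp add: p_def)
          then show False
            using vK' free assms(2) unfolding collapse_def free_face_def face_def by blast
        qed
        have mB: "m \<le> v - indicator_vec B"
          unfolding less_eq_vec_def
        proof
          fix i
          show "m $ i \<le> (v - indicator_vec B) $ i"
            using Ints_less_imp_add1_le[OF integer_vectorsD[OF m, of i] integer_vectorsD[OF vi, of i]]
              mv[unfolded less_eq_vec_def, rule_format, of i]
            by (auto simp: B_def indicator_vec_nth)
        qed
        have "{v - indicator_vec B..v} \<subseteq> {m..M}"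
          using mB vM by (simp add: atLeastatMost_subset_iff)
        then have "{v - indicator_vec B..v} \<subseteq> K" using \<sigma>K unfolding m_def by (rule order_trans)
        moreover have "B \<noteq> {}" using AB Ane by blast
        ultimately have BL: "B \<in> past_link_complex K v" unfolding past_link_complex_eq by blast
        \<comment> \<open>The cone vertex of the collapse: \<open>\<sigma>\<close> has width at most
          one in direction \<open>i\<close>, so \<open>m $ i < p $ i\<close> pushes \<open>p\<close>
          to the upper end. There \<open>p $ i = v $ i\<close>, which puts \<open>i\<close> in
          \<open>B\<close> but not in \<open>A\<close>.\<close>
        obtain i where i: "m $ i < p $ i"
          using \<open>m \<noteq> p\<close> mp unfolding less_eq_vec_def vec_eq_iff by (metis order_le_less)
        have "m $ i + 1 \<le> p $ i"
          using i by (intro Ints_less_imp_add1_le integer_vectorsD m p)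
        moreover have "M $ i \<le> m $ i + 1" by (simp add: m_def indicator_vec_nth)
        moreover have "v $ i \<le> M $ i" "p $ i \<le> v $ i"
          using vM pq qv order_trans[OF pq qv] by (auto simp: less_eq_vec_def)
        ultimately have iB: "i \<in> B" and iA: "i \<notin> A" using i by (auto simp: A_def B_def)
        have "s \<subseteq> B" if s: "s \<in> past_link_complex K v" "A \<subseteq> s" for s
        proof
          fix k assume k: "k \<in> s"
          have "{v - indicator_vec s..v} \<subseteq> {m..M}" using coface[OF vi s(1)] s(2) iff by blast
          then have "m \<le> v - indicator_vec s"
            using indicator_vec_nonneg[of s] by (simp add: atLeastatMost_subset_iff)
          then have "m $ k \<le> v $ k - 1"
            using k by (auto simp: less_eq_vec_def indicator_vec_nth dest: spec[of _ k])
          then show "k \<in> B" by (simp add: B_def)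
        qed
        then show ?thesis
          unfolding link[OF vi] iff
          by (intro geometric_realization_collapse[OF abstract_simplicial_complex_past_link Ane AB BL iB iA])
      qed
    qed
    then show "lpdc_pair K \<tau> \<sigma>" using free unfolding lpdc_pair_def by blast
  qed
qed

end
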